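(* Let $X$ be a Tychonoff space and let $L(X)$ be the free locally convex space over $X$. For a nonzero subset $A$ of $L(X)$ (that is, $A$ is nonempty and $A\neq\{0\}$) the following assertions are equivalent: (i) $A$ is bounded; (ii) $\mathrm{supp}(A)$ has compact closure in the Dieudonné completion $\mu X$ of $X$ and $C_A$ is finite; (iii) $\mathrm{supp}(A)$ is functionally bounded in $X$ and $C_A$ is finite.
   Context: Locally convex spaces (lcs) are real and Hausdorff; Tychonoff means completely regular and Hausdorff. The free locally convex space over a Tychonoff space $X$ is an lcs $L(X)$ with a continuous map $i:X\to L(X)$ such that for every continuous map $f$ from $X$ to an lcs $E$ there is a unique continuous linear operator $\bar f:L(X)\to E$ with $f=\bar f\circ i$. It exists and is essentially unique, and $i$ is a topological embedding whose image is a Hamel basis of $L(X)$; $x\in X$ is identified with $i(x)$. For $\chi=a_1x_1+\dots+a_nx_n\in L(X)$ with distinct $x_1,\dots,x_n\in X$ and nonzero $a_1,\dots,a_n\in\mathbb{R}$, put $\|\chi\|:=|a_1|+\dots+|a_n|$ and $\mathrm{supp}(\chi):=\{x_1,\dots,x_n\}$ (for $\chi=0$: $\|\chi\|=0$ and empty support). For $A\subseteq L(X)$, $\mathrm{supp}(A):=\bigcup_{\chi\in A}\mathrm{supp}(\chi)$ and $C_A:=\sup\{\|\chi\|:\chi\in A\}$. A subset of $X$ is functionally bounded in $X$ if every continuous $f:X\to\mathbb{R}$ is bounded on it. The Dieudonné completion $\mu X$ is the completion of the uniform space $(X,\mathcal{U}_X)$, where $\mathcal{U}_X$ is the universal uniformity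 (the finest uniformity compatible with the topology of $X$). *)

theory Defs
  imports "HOL-Analysis.Analysis"
begin

section \<open>Locally convex spaces\<close>

text \<open>The underlying vector space is the linear subspace \<^term>\<open>topspace T\<close> of a type of
  class \<^class>\<open>real_vector\<close>; the type itself carries no topology.\<close>

definition lcs :: "'v::real_vector topology \<Rightarrow> bool" where
  "lcs T \<longleftrightarrow>
     subspace (topspace T) \<and>
     continuous_map (prod_topology T T) T (\<lambda>(x, y). x + y) \<and>
     continuous_map (prod_topology euclideanreal T) T (\<lambda>(c, x). c *\<^sub>R x) \<and>
     (\<forall>U. openin T U \<and> 0 \<in> U \<longrightarrow> (\<exists>W. openin T W \<and> 0 \<in> W \<and> convex W \<and> W \<subseteq> U)) \<and>
     Hausdorff_space T"

definition lcs_bounded :: "'v::real_vector topology \<Rightarrow> 'v set \<Rightarrow> bool" where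
  "lcs_bounded T A \<longleftrightarrow>
     A \<subseteq> topspace T \<and>
     (\<forall>U. openin T U \<and> 0 \<in> U \<longrightarrow> (\<exists>s>0. \<forall>t>s. A \<subseteq> (*\<^sub>R) t ` U))"


section \<open>The free locally convex space\<close>

definition lcs_extension_property ::
  "'e::real_vector itself \<Rightarrow> 'a topology \<Rightarrow> 'v::real_vector topology \<Rightarrow> ('a \<Rightarrow> 'v) \<Rightarrow> bool"
where
  "lcs_extension_property t X L i \<longleftrightarrow>
     (\<forall>(E :: 'e topology) f. lcs E \<and> continuous_map X E f \<longrightarrow>
        (\<exists>!g. linear g \<and> continuous_map L E g \<and> (\<forall>x\<in>topspace X. g (i x) = f x)))"

text \<open>HOL cannot quantify over the type carrying the target space \<open>E\<close> inside a definition.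
  It is enough to use the targets carried by linear subspaces of \<open>L\<close> itself and the targets
  carried by the real line: the theorem \<open>free_lcs_extension_property\<close> below derives the
  universal property for all locally convex spaces \<open>E\<close>, over any type.\<close>

definition free_lcs ::
  "'a topology \<Rightarrow> 'v::real_vector topology \<Rightarrow> ('a \<Rightarrow> 'v) \<Rightarrow> bool"
where
  "free_lcs X L i \<longleftrightarrow>
     lcs L \<and> topspace L = UNIV \<and> continuous_map X L i \<and>
     lcs_extension_property TYPE('v) X L i \<and>
     lcs_extension_property TYPE(real) X L i"

text \<open>\<^term>\<open>representation B v b\<close> is the coefficient of \<open>b\<close> in the expansion of \<open>v\<close> with
  respect to \<open>B\<close>. It is meaningful here because \<open>i\<close> is injective and its image is a Hamel basis,
  see \<open>free_lcs_inj_on\<close>, \<open>free_lcs_independent\<close> and \<open>free_lcs_span\<close> below.\<close>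

definition supp :: "'a topology \<Rightarrow> ('a \<Rightarrow> 'v::real_vector) \<Rightarrow> 'v \<Rightarrow> 'a set" where
  "supp X i w = {x \<in> topspace X. representation (i ` topspace X) w (i x) \<noteq> 0}"

definition coeff_norm :: "'a topology \<Rightarrow> ('a \<Rightarrow> 'v::real_vector) \<Rightarrow> 'v \<Rightarrow> real" where
  "coeff_norm X i w = (\<Sum>x\<in>supp X i w. \<bar>representation (i ` topspace X) w (i x)\<bar>)"

definition supp_set :: "'a topology \<Rightarrow> ('a \<Rightarrow> 'v::real_vector) \<Rightarrow> 'v set \<Rightarrow> 'a set" where
  "supp_set X i A = (\<Union>w\<in>A. supp X i w)"

definition coeff_sup :: "'a topology \<Rightarrow> ('a \<Rightarrow> 'v::real_vector) \<Rightarrow> 'v set \<Rightarrow> ereal" where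
  "coeff_sup X i A = (SUP w\<in>A. ereal (coeff_norm X i w))"

definition functionally_bounded_in :: "'a topology \<Rightarrow> 'a set \<Rightarrow> bool" where
  "functionally_bounded_in X S \<longleftrightarrow>
     S \<subseteq> topspace X \<and> (\<forall>f. continuous_map X euclideanreal f \<longrightarrow> bounded (f ` S))"


section \<open>Uniform spaces and the Dieudonne completion\<close>

text \<open>A uniformity on the set \<open>S\<close>, in the filter style of the class \<^class>\<open>uniform_space\<close>: the
  entourages are the sets of pairs on which \<open>U\<close> eventually holds.\<close>

definition is_uniformity :: "'a set \<Rightarrow> ('a \<times> 'a) filter \<Rightarrow> bool" where
  "is_uniformity S U \<longleftrightarrow>
     U \<le> principal (S \<times> S) \<and>
     (\<forall>E. eventually E U \<longrightarrow>
        (\<forall>x\<in>S. E (x, x)) \<and>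
        eventually (\<lambda>(x, y). E (y, x)) U \<and>
        (\<exists>D. eventually D U \<and> (\<forall>x y z. D (x, y) \<longrightarrow> D (y, z) \<longrightarrow> E (x, z))))"

definition uniform_topology :: "'a set \<Rightarrow> ('a \<times> 'a) filter \<Rightarrow> 'a topology" where
  "uniform_topology S U =
     topology (\<lambda>W. W \<subseteq> S \<and> (\<forall>x\<in>W. eventually (\<lambda>(x', y). x' = x \<longrightarrow> y \<in> W) U))"

lemma openin_uniform_topology:
  "openin (uniform_topology S U) W \<longleftrightarrow>
     W \<subseteq> S \<and> (\<forall>x\<in>W. eventually (\<lambda>(x', y). x' = x \<longrightarrow> y \<in> W) U)"
proof -
  let ?P = "\<lambda>W. W \<subseteq> S \<and> (\<forall>x\<in>W. eventually (\<lambda>(x', y). x' = x \<longrightarrow> y \<in> W) U)"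
  have "istopology ?P"
    unfolding istopology_def
  proof (intro conjI allI impI)
    fix V W assume VW: "?P V" "?P W"
    then show "V \<inter> W \<subseteq> S" by blast
    show "\<forall>x\<in>V \<inter> W. eventually (\<lambda>(x', y). x' = x \<longrightarrow> y \<in> V \<inter> W) U"
    proof
      fix x assume "x \<in> V \<inter> W"
      with VW have "eventually (\<lambda>(x', y). x' = x \<longrightarrow> y \<in> V) U"
        "eventually (\<lambda>(x', y). x' = x \<longrightarrow> y \<in> W) U" by auto
      then show "eventually (\<lambda>(x', y). x' = x \<longrightarrow> y \<in> V \<inter> W) U"
        by eventually_elim auto
    qed
  next
    fix \<K> assume K: "\<forall>K\<in>\<K>. ?P K"
    then show "\<Union>\<K> \<subseteq> S" by blast
    show "\<forall>x\<in>\<Union>\<K>. eventually (\<lambda>(x', y). x' = x \<longrightarrow> y \<in> \<Union>\<K>) U"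
    proof
      fix x assume "x \<in> \<Union>\<K>"
      then obtain K where "K \<in> \<K>" "x \<in> K" by blast
      with K have "eventually (\<lambda>(x', y). x' = x \<longrightarrow> y \<in> K) U" by blast
      then show "eventually (\<lambda>(x', y). x' = x \<longrightarrow> y \<in> \<Union>\<K>) U"
        by eventually_elim (use \<open>K \<in> \<K>\<close> in auto)
    qed
  qed
  then show ?thesis
    unfolding uniform_topology_def by (simp add: topology_inverse')
qed

lemma topspace_uniform_topology:
  assumes "is_uniformity S U"
  shows "topspace (uniform_topology S U) = S"
proof -
  have "eventually (\<lambda>p. p \<in> S \<times> S) U"
    using assms by (auto simp: is_uniformity_def le_principal)
  then have "eventually (\<lambda>(x', y). x' = x \<longrightarrow> y \<in> S) U" for x
    by eventually_elim auto
  then have "openin (uniform_topology S U) S"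
    by (auto simp: openin_uniform_topology)
  then show ?thesis
    by (metis openin_uniform_topology openin_subset openin_topspace subset_antisym)
qed

text \<open>A finer uniformity has more entourages, hence is a smaller filter.\<close>

definition universal_uniformity :: "'a topology \<Rightarrow> ('a \<times> 'a) filter" where
  "universal_uniformity X =
     (LEAST U. is_uniformity (topspace X) U \<and> uniform_topology (topspace X) U = X)"

definition complete_uniformity :: "'a set \<Rightarrow> ('a \<times> 'a) filter \<Rightarrow> bool" where
  "complete_uniformity S U \<longleftrightarrow>
     (\<forall>F. F \<noteq> bot \<and> F \<le> principal S \<and> F \<times>\<^sub>F F \<le> U \<longrightarrow>
        (\<exists>y\<in>S. F \<le> nhdsin (uniform_topology S U) y))"

text \<open>\<open>(M, V)\<close> with \<open>j : S \<rightarrow> M\<close> is the (Hausdorff) completion of the uniform space \<open>(S, U)\<close>: a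
  complete Hausdorff uniform space in which \<open>(S, U)\<close> is embedded as a dense uniform subspace.\<close>

definition uniform_completion ::
  "'a set \<Rightarrow> ('a \<times> 'a) filter \<Rightarrow> 'c set \<Rightarrow> ('c \<times> 'c) filter \<Rightarrow> ('a \<Rightarrow> 'c) \<Rightarrow> bool"
where
  "uniform_completion S U M V j \<longleftrightarrow>
     is_uniformity M V \<and> Hausdorff_space (uniform_topology M V) \<and> complete_uniformity M V \<and>
     j ` S \<subseteq> M \<and> inj_on j S \<and>
     U = inf (filtercomap (map_prod j j) V) (principal (S \<times> S)) \<and>
     uniform_topology M V closure_of (j ` S) = M"

definition dieudonne_completion ::
  "'a topology \<Rightarrow> 'c set \<Rightarrow> ('c \<times> 'c) filter \<Rightarrow> ('a \<Rightarrow> 'c) \<Rightarrow> bool"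
where
  "dieudonne_completion X M V j \<longleftrightarrow> uniform_completion (topspace X) (universal_uniformity X) M V j"


section \<open>The universal property over arbitrary types\<close>

lemma lcs_convex_nbhd:
  assumes "lcs T" "openin T U" "0 \<in> U"
  obtains W where "openin T W" "0 \<in> W" "convex W" "W \<subseteq> U"
  using assms by (auto simp: lcs_def)

lemma lcs_extension_ex1:
  fixes E :: "'e::real_vector topology"
  assumes "lcs_extension_property TYPE('e) X L i" "lcs E" "continuous_map X E f"
  shows "\<exists>!g. linear g \<and> continuous_map L E g \<and> (\<forall>x\<in>topspace X. g (i x) = f x)"
  using assms by (simp add: lcs_extension_property_def)

lemma lcs_extension_ex:
  fixes E :: "'e::real_vector topology"
  assumes "lcs_extension_property TYPE('e) X L i" "lcs E" "continuous_map X E f"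
  obtains g where "linear g" "continuous_map L E g" "\<forall>x\<in>topspace X. g (i x) = f x"
  using ex1_implies_ex[OF lcs_extension_ex1[OF assms]] by (elim exE conjE)

lemma lcs_real: "lcs euclideanreal"
proof -
  have "continuous_map (prod_topology euclideanreal euclideanreal) euclideanreal (\<lambda>(x, y). x + y)"
    "continuous_map (prod_topology euclideanreal euclideanreal) euclideanreal (\<lambda>(c, x). c *\<^sub>R x)"
    unfolding euclidean_product_topology
    by (auto simp: split_beta' intro!: continuous_intros)
  moreover have "\<exists>W. open W \<and> 0 \<in> W \<and> convex W \<and> W \<subseteq> U"
    if "open U" "(0::real) \<in> U" for U
    using that by (meson open_contains_ball open_ball centre_in_ball convex_ball)
  ultimately show ?thesis
    by (auto simp: lcs_def)
qed

lemma lcs_subtopology: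
  assumes "lcs T" "subspace S"
  shows "lcs (subtopology T S)"
  unfolding lcs_def
proof (intro conjI allI impI)
  have sub: "subspace (topspace T)"
    using assms by (simp add: lcs_def)
  show S: "subspace (topspace (subtopology T S))"
    using sub assms(2) by (simp add: subspace_inter)
  have add: "continuous_map (prod_topology T T) T (\<lambda>(x, y). x + y)"
    and scale: "continuous_map (prod_topology euclideanreal T) T (\<lambda>(c, x). c *\<^sub>R x)"
    using assms by (auto simp: lcs_def)
  have "continuous_map (prod_topology (subtopology T S) (subtopology T S)) T (\<lambda>(x, y). x + y)"
    using continuous_map_from_subtopology[OF add, of "S \<times> S"]
    by (simp add: subtopology_Times)
  then show "continuous_map (prod_topology (subtopology T S) (subtopology T S))
      (subtopology T S) (\<lambda>(x, y). x + y)"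
    using assms(2) by (auto simp: continuous_map_in_subtopology subspace_add)
  have "continuous_map (prod_topology euclideanreal (subtopology T S)) T (\<lambda>(c, x). c *\<^sub>R x)"
    using continuous_map_from_subtopology[OF scale, of "UNIV \<times> S"]
    by (simp add: subtopology_Times)
  then show "continuous_map (prod_topology euclideanreal (subtopology T S))
      (subtopology T S) (\<lambda>(c, x). c *\<^sub>R x)"
    using assms(2) by (auto simp: continuous_map_in_subtopology subspace_scale)
  show "Hausdorff_space (subtopology T S)"
    using assms by (simp add: lcs_def Hausdorff_space_subtopology)
  fix U assume "openin (subtopology T S) U \<and> 0 \<in> U"
  then obtain U' where U': "openin T U'" "U = U' \<inter> S" "0 \<in> U'"
    by (auto simp: openin_subtopology)
  obtain W where W: "openin T W" "0 \<in> W" "convex W" "W \<subseteq> U'"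
    by (rule lcs_convex_nbhd[OF assms(1) U'(1,3)])
  have "openin (subtopology T S) (W \<inter> S)" "0 \<in> W \<inter> S" "convex (W \<inter> S)" "W \<inter> S \<subseteq> U"
    using W U' assms(2)
    by (auto simp: openin_subtopology subspace_0 intro: convex_Int subspace_imp_convex)
  then show "\<exists>W. openin (subtopology T S) W \<and> 0 \<in> W \<and> convex W \<and> W \<subseteq> U"
    by blast
qed

text \<open>The coarsest topology refining \<open>L\<close> that makes the linear map \<open>g\<close> continuous is again
  locally convex.\<close>

lemma lcs_graph_topology:
  fixes L :: "'v::real_vector topology" and E :: "'e::real_vector topology"
  assumes L: "lcs L" "topspace L = UNIV" and E: "lcs E"
    and g: "linear g" "range g \<subseteq> topspace E"
  shows "lcs (pullback_topology UNIV (\<lambda>v. (v, g v)) (prod_topology L E))" (is "lcs ?T")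
proof -
  let ?h = "\<lambda>v. (v, g v)"
  have top: "topspace ?T = UNIV"
    using L g by (auto simp: topspace_pullback_topology)
  have h: "continuous_map ?T (prod_topology L E) ?h"
    using continuous_map_pullback[of "prod_topology L E" "prod_topology L E" id UNIV ?h]
    by (simp add: o_def)
  have h1: "continuous_map ?T L (\<lambda>v. v)" and h2: "continuous_map ?T E g"
    using h by (simp_all add: continuous_map_paired)
  have into: "continuous_map Z ?T k"
    if "continuous_map Z L k" "continuous_map Z E (\<lambda>z. g (k z))" for Z :: "'z topology" and k
    using that
    by (intro continuous_map_pullback') (auto simp: o_def continuous_map_paired)
  have addL: "continuous_map (prod_topology L L) L (\<lambda>(x, y). x + y)"
    and addE: "continuous_map (prod_topology E E) E (\<lambda>(x, y). x + y)"
    and scaleL: "continuous_map (prod_topology euclideanreal L) L (\<lambda>(c, x). c *\<^sub>R x)"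
    and scaleE: "continuous_map (prod_topology euclideanreal E) E (\<lambda>(c, x). c *\<^sub>R x)"
    using L E by (auto simp: lcs_def)
  have fst1: "continuous_map (prod_topology ?T ?T) ?T fst"
    and snd1: "continuous_map (prod_topology ?T ?T) ?T snd"
    and fst2: "continuous_map (prod_topology euclideanreal ?T) euclideanreal fst"
    and snd2: "continuous_map (prod_topology euclideanreal ?T) ?T snd"
    by (simp_all add: continuous_map_fst continuous_map_snd)
  have "continuous_map (prod_topology ?T ?T) ?T (\<lambda>p. fst p + snd p)"
  proof (rule into)
    have "continuous_map (prod_topology ?T ?T) (prod_topology L L) (\<lambda>p. (fst p, snd p))"
      using continuous_map_compose[OF fst1 h1] continuous_map_compose[OF snd1 h1]
      by (intro continuous_map_pairedI) (simp_all add: o_def)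
    from continuous_map_compose[OF this addL]
    show "continuous_map (prod_topology ?T ?T) L (\<lambda>p. fst p + snd p)"
      by (simp add: o_def split_beta')
    have "continuous_map (prod_topology ?T ?T) (prod_topology E E) (\<lambda>p. (g (fst p), g (snd p)))"
      using continuous_map_compose[OF fst1 h2] continuous_map_compose[OF snd1 h2]
      by (intro continuous_map_pairedI) (simp_all add: o_def)
    from continuous_map_compose[OF this addE]
    show "continuous_map (prod_topology ?T ?T) E (\<lambda>p. g (fst p + snd p))"
      by (simp add: o_def split_beta' linear_add[OF g(1)])
  qed
  moreover have "continuous_map (prod_topology euclideanreal ?T) ?T (\<lambda>p. fst p *\<^sub>R snd p)"
  proof (rule into)
    have "continuous_map (prod_topology euclideanreal ?T) (prod_topology euclideanreal L)
        (\<lambda>p. (fst p, snd p))"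
      using fst2 continuous_map_compose[OF snd2 h1]
      by (intro continuous_map_pairedI) (simp_all add: o_def)
    from continuous_map_compose[OF this scaleL]
    show "continuous_map (prod_topology euclideanreal ?T) L (\<lambda>p. fst p *\<^sub>R snd p)"
      by (simp add: o_def split_beta')
    have "continuous_map (prod_topology euclideanreal ?T) (prod_topology euclideanreal E)
        (\<lambda>p. (fst p, g (snd p)))"
      using fst2 continuous_map_compose[OF snd2 h2]
      by (intro continuous_map_pairedI) (simp_all add: o_def)
    from continuous_map_compose[OF this scaleE]
    show "continuous_map (prod_topology euclideanreal ?T) E (\<lambda>p. g (fst p *\<^sub>R snd p))"
      by (simp add: o_def split_beta' linear_scale[OF g(1)])
  qed
  moreover have "\<exists>W. openin ?T W \<and> 0 \<in> W \<and> convex W \<and> W \<subseteq> U"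
    if U: "openin ?T U" "0 \<in> U" for U
  proof -
    obtain O' where O': "openin (prod_topology L E) O'" "U = ?h -` O'"
      using U(1) by (auto simp: openin_pullback_topology)
    with U(2) have "(0, 0) \<in> O'"
      by (simp add: linear_0[OF g(1)])
    then have "\<exists>P Q. openin L P \<and> openin E Q \<and> 0 \<in> P \<and> 0 \<in> Q \<and> P \<times> Q \<subseteq> O'"
      using O'(1) by (simp add: openin_prod_topology_alt)
    then obtain P Q where PQ: "openin L P" "openin E Q" "0 \<in> P" "0 \<in> Q" "P \<times> Q \<subseteq> O'"
      by (elim exE conjE)
    obtain P' where P': "openin L P'" "0 \<in> P'" "convex P'" "P' \<subseteq> P"
      using lcs_convex_nbhd[OF L(1) PQ(1,3)] .
    obtain Q' where Q': "openin E Q'" "0 \<in> Q'" "convex Q'" "Q' \<subseteq> Q"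
      using lcs_convex_nbhd[OF E PQ(2,4)] .
    have eq: "?h -` (P' \<times> Q') = P' \<inter> g -` Q'"
      by auto
    have "openin ?T (P' \<inter> g -` Q')"
      unfolding openin_pullback_topology
      using P'(1) Q'(1) eq by (intro exI[of _ "P' \<times> Q'"]) (auto simp: openin_prod_Times_iff)
    moreover have "convex (P' \<inter> g -` Q')"
      using P'(3) convex_linear_vimage[OF g(1) Q'(3)] by (simp add: convex_Int)
    moreover have "0 \<in> P' \<inter> g -` Q'"
      using P'(2) Q'(2) by (simp add: linear_0[OF g(1)])
    moreover have "P' \<inter> g -` Q' \<subseteq> U"
      using subset_trans[OF Sigma_mono[OF P'(4) Q'(4)] PQ(5)] O'(2) by auto
    ultimately show ?thesis by blast
  qed
  moreover have "Hausdorff_space ?T"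
    unfolding Hausdorff_space_def
  proof (intro allI impI)
    fix x y assume "x \<in> topspace ?T \<and> y \<in> topspace ?T \<and> x \<noteq> y"
    then obtain U V where UV: "openin L U" "openin L V" "x \<in> U" "y \<in> V" "disjnt U V"
      using L unfolding lcs_def Hausdorff_space_def by (metis UNIV_I)
    have "openin ?T U" "openin ?T V"
      using openin_continuous_map_preimage[OF h1 UV(1)]
        openin_continuous_map_preimage[OF h1 UV(2)] top by auto
    with UV show "\<exists>U V. openin ?T U \<and> openin ?T V \<and> x \<in> U \<and> y \<in> V \<and> disjnt U V"
      by blast
  qed
  ultimately show ?thesis
    unfolding lcs_def top by (auto simp: split_beta')
qed

lemma free_lcs_span:
  fixes L :: "'b::real_vector topology"
  assumes "free_lcs X L i"
  shows "span (i ` topspace X) = UNIV"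
proof -
  let ?S = "span (i ` topspace X)"
  have L: "lcs L" "topspace L = UNIV" "continuous_map X L i"
    and ext: "lcs_extension_property TYPE('b) X L i"
    using assms by (auto simp: free_lcs_def)
  have "continuous_map X (subtopology L ?S) i"
    using L(3) by (auto simp: continuous_map_in_subtopology intro: span_base)
  then obtain g where g: "linear g" "continuous_map L (subtopology L ?S) g"
    "\<forall>x\<in>topspace X. g (i x) = i x"
    by (rule lcs_extension_ex[OF ext lcs_subtopology[OF L(1) subspace_span]])
  have uniq: "\<exists>!k. linear k \<and> continuous_map L L k \<and> (\<forall>x\<in>topspace X. k (i x) = i x)"
    by (rule lcs_extension_ex1[OF ext L(1,3)])
  have "linear g \<and> continuous_map L L g \<and> (\<forall>x\<in>topspace X. g (i x) = i x)"
    using g continuous_map_into_fulltopology[OF g(2)] by blast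
  moreover have "linear (\<lambda>v. v) \<and> continuous_map L L (\<lambda>v. v) \<and> (\<forall>x\<in>topspace X. i x = i x)"
    using continuous_map_id[of L] linear_ident by (simp add: id_def)
  ultimately have "g = (\<lambda>v. v)"
    by (rule trans[OF the1_equality[OF uniq, symmetric] the1_equality[OF uniq]])
  moreover have "range g \<subseteq> ?S"
    using g(2) L(2) by (auto simp: continuous_map_in_subtopology)
  ultimately show ?thesis by auto
qed

lemma free_lcs_separating:
  assumes X: "completely_regular_space X" "Hausdorff_space X" and free: "free_lcs X L i"
    and F: "finite F" "F \<subseteq> topspace X" "x \<in> topspace X" "x \<notin> F"
  shows "\<exists>k :: 'v::real_vector \<Rightarrow> real. linear k \<and> k (i x) = 1 \<and> (\<forall>y\<in>F. k (i y) = 0)"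
proof -
  have "closedin X F"
    using X(2) F by (meson closedin_Hausdorff_finite)
  with X(1) F have "\<exists>f. continuous_map X euclideanreal f \<and> f x = 1 \<and> f ` F \<subseteq> {0}"
    using completely_regular_space_gen_alt[of "1::real" 0 X] by simp
  then obtain f where f: "continuous_map X euclideanreal f" "f x = 1" "f ` F \<subseteq> {0}"
    by (elim exE conjE)
  have "lcs_extension_property TYPE(real) X L i"
    using free by (simp add: free_lcs_def)
  from lcs_extension_ex[OF this lcs_real f(1)]
  obtain k where "linear k" "\<forall>x\<in>topspace X. k (i x) = f x" .
  with f F show ?thesis by (intro exI[of _ k]) auto
qed

lemma free_lcs_inj_on:
  assumes "completely_regular_space X" "Hausdorff_space X" "free_lcs X L i"
  shows "inj_on i (topspace X)"
proof (rule inj_onI, rule ccontr)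
  fix x y assume xy: "x \<in> topspace X" "y \<in> topspace X" "i x = i y" "x \<noteq> y"
  with free_lcs_separating[OF assms, of "{y}" x] show False by auto
qed

lemma free_lcs_independent:
  fixes L :: "'b::real_vector topology"
  assumes "completely_regular_space X" "Hausdorff_space X" "free_lcs X L i"
  shows "independent (i ` topspace X)"
proof
  assume "dependent (i ` topspace X)"
  then obtain T u v where T: "finite T" "T \<subseteq> i ` topspace X" "(\<Sum>v\<in>T. u v *\<^sub>R v) = 0"
    and v: "v \<in> T" "u v \<noteq> 0"
    unfolding dependent_explicit by blast
  obtain F where F: "F \<subseteq> topspace X" "finite F" "T = i ` F"
    using T by (meson finite_subset_image)
  obtain x where x: "x \<in> F" "v = i x" using F v by blast
  obtain k :: "'b \<Rightarrow> real" where k: "linear k" "k (i x) = 1" "\<forall>y\<in>F - {x}. k (i y) = 0"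
    using free_lcs_separating[OF assms, of "F - {x}" x] F x by auto
  have "k w = (if w = v then 1 else 0)" if "w \<in> T" for w
    using that F x k by auto
  then have "(\<Sum>w\<in>T. u w * k w) = (\<Sum>w\<in>T. if w = v then u w else 0)"
    by (intro sum.cong) auto
  then have "(\<Sum>w\<in>T. u w * k w) = u v"
    using T(1) v(1) by simp
  moreover have "(\<Sum>w\<in>T. u w * k w) = k (\<Sum>w\<in>T. u w *\<^sub>R w)"
    by (simp add: linear_sum[OF k(1)] linear_scale[OF k(1)])
  ultimately show False
    using T(3) v(2) linear_0[OF k(1)] by simp
qed

theorem free_lcs_extension_property:
  fixes L :: "'b::real_vector topology"
  assumes X: "completely_regular_space X" "Hausdorff_space X" and free: "free_lcs X L i"
  shows "lcs_extension_property TYPE('e::real_vector) X L i"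
  unfolding lcs_extension_property_def
proof (intro allI impI)
  fix E :: "'e topology" and f
  assume "lcs E \<and> continuous_map X E f"
  then have E: "lcs E" and f: "continuous_map X E f" by auto
  let ?B = "i ` topspace X"
  have inj: "inj_on i (topspace X)" and ind: "independent ?B" and span: "span ?B = UNIV"
    using free_lcs_inj_on[OF X free] free_lcs_independent[OF X free] free_lcs_span[OF free] .
  have L: "lcs L" "topspace L = UNIV" "continuous_map X L i"
    using free by (auto simp: free_lcs_def)
  have unique: "k = k'"
    if "linear k" "linear k'" "\<forall>x\<in>topspace X. k (i x) = k' (i x)"
    for k k' :: "'b \<Rightarrow> 'z::real_vector"
  proof
    fix v show "k v = k' v"
      by (rule linear_eq_on_span[OF that(1,2), of ?B]) (use that(3) span in auto)
  qed
  obtain g where g: "linear g" "\<forall>b\<in>?B. g b = f (the_inv_into (topspace X) i b)"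
    using linear_independent_extend[OF ind, of "\<lambda>b. f (the_inv_into (topspace X) i b)"]
    by (elim exE conjE)
  have gi: "g (i x) = f x" if "x \<in> topspace X" for x
    using that g(2) inj by (simp add: the_inv_into_f_f)
  have "g ` ?B \<subseteq> topspace E"
    using f gi by (auto simp: continuous_map_def)
  moreover have "subspace (topspace E)"
    using E by (simp add: lcs_def)
  ultimately have "g ` span ?B \<subseteq> topspace E"
    unfolding linear_span_image[OF g(1), symmetric] by (rule span_minimal)
  then have range: "range g \<subseteq> topspace E"
    by (simp add: span)
  define T where "T = pullback_topology UNIV (\<lambda>v. (v, g v)) (prod_topology L E)"
  have T: "lcs T"
    unfolding T_def by (rule lcs_graph_topology[OF L(1,2) E g(1) range])
  have "continuous_map X E (\<lambda>x. g (i x))"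
    using continuous_map_eq[OF f] gi by simp
  then have contT: "continuous_map X T i"
    unfolding T_def using L(3)
    by (intro continuous_map_pullback') (auto simp: o_def continuous_map_paired)
  have "lcs_extension_property TYPE('b) X L i"
    using free by (simp add: free_lcs_def)
  then obtain k where k: "linear k" "continuous_map L T k" "\<forall>x\<in>topspace X. k (i x) = i x"
    by (rule lcs_extension_ex[OF _ T contT])
  have "k = (\<lambda>v. v)"
    by (rule unique) (use k in \<open>auto intro: linear_ident\<close>)
  moreover have "continuous_map T E g"
    using continuous_map_pullback[of "prod_topology L E" E snd UNIV "\<lambda>v. (v, g v)"]
    by (simp add: T_def o_def continuous_map_snd)
  ultimately have "continuous_map L E g"
    using continuous_map_compose[OF k(2), of E g] by (simp add: o_def)
  then have ex: "linear g \<and> continuous_map L E g \<and> (\<forall>x\<in>topspace X. g (i x) = f x)"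
    using g(1) gi by blast
  show "\<exists>!g. linear g \<and> continuous_map L E g \<and> (\<forall>x\<in>topspace X. g (i x) = f x)"
    by (rule ex1I[of _ g], rule ex, rule unique) (use ex in auto)
qed

end

theory Submission
  imports Defs
begin

text \<open>The proof rests on two equivalences, one for bounded subsets of \<open>L\<close> and one for functionally
bounded subsets of \<open>X\<close>.

Bounded means functionally bounded support and bounded coefficient norms
(\<open>lcs_bounded_iff_functionally_bounded\<close>). A continuous function \<open>f\<close> on \<open>X\<close> extends to a
continuous functional on \<open>L\<close>, which is bounded on a bounded set \<open>A\<close>. So the elements of \<open>A\<close>,
seen as finite combinations of point evaluations, are pointwise bounded on all continuous
functions. The norm of such a combination as a functional on bounded continuous functions is
the sum of the absolute values of its coefficients, since finitely many values can be
prescribed in a Tychonoff space; a gliding hump argument therefore bounds these sums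
(\<open>uniform_bound_of_coefficient_sums\<close>). The same bound applied after multiplying all
coefficients by \<open>\<phi> \<bar>g x\<bar>\<close> controls the supports: if \<open>g\<close> were unbounded on their union, a
sufficiently fast growing \<open>\<phi>\<close> would make the weighted sums unbounded
(\<open>supports_functionally_bounded\<close>). Conversely, a continuous seminorm on \<open>L\<close> restricts to a
continuous function on \<open>X\<close>, is bounded on the supports, and hence on \<open>A\<close> by the triangle
inequality and the bound on the coefficient norms. The seminorms are Minkowski functionals of convex symmetric neighbourhoods.

Functionally bounded means relatively compact in the Dieudonne completion
(\<open>functionally_bounded_iff_compact_closure\<close>). Both amount to total boundedness for the
universal uniformity. A continuous real function is uniformly continuous for that uniformity,
so it is bounded on totally bounded sets. If a set is not totally bounded, it contains a
uniformly discrete sequence, and bumps of growing height around its points add up to a continuous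
unbounded function. On the side of the completion, compact sets are totally bounded, and in a
complete uniform space closed totally bounded sets are compact, by way of ultrafilters.\<close>

section \<open>Entourages and neighbourhoods\<close>

lemma uniformity_subset:
  assumes "is_uniformity S U"
  shows "eventually (\<lambda>p. p \<in> S \<times> S) U"
  using assms by (auto simp: is_uniformity_def le_principal)

lemma uniformity_refl:
  assumes "is_uniformity S U" "eventually E U" "x \<in> S"
  shows "E (x, x)"
  using assms by (auto simp: is_uniformity_def)

lemma uniformity_sym_half:
  assumes U: "is_uniformity S U" and E: "eventually E U"
  obtains D where "eventually D U" "\<forall>x y. D (x, y) \<longrightarrow> D (y, x)"
    "\<forall>x y z. D (x, y) \<longrightarrow> D (y, z) \<longrightarrow> E (x, z)" "\<forall>x y. D (x, y) \<longrightarrow> x \<in> S \<and> y \<in> S"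
proof -
  obtain D where D: "eventually D U" "\<forall>x y z. D (x, y) \<longrightarrow> D (y, z) \<longrightarrow> E (x, z)"
    using U E unfolding is_uniformity_def by blast
  have "eventually (\<lambda>(x, y). D (y, x)) U"
    using U D(1) by (simp add: is_uniformity_def)
  then have "eventually (\<lambda>(x, y). D (x, y) \<and> D (y, x) \<and> x \<in> S \<and> y \<in> S) U"
    using D(1) uniformity_subset[OF U] by eventually_elim auto
  then show thesis
    by (rule that) (use D(2) in auto)
qed

lemma uniformity_sym_quarter:
  assumes U: "is_uniformity S U" and E: "eventually E U"
  obtains D where "eventually D U" "\<forall>x y. D (x, y) \<longrightarrow> D (y, x)"
    "\<forall>v w x y z. D (v, w) \<longrightarrow> D (w, x) \<longrightarrow> D (x, y) \<longrightarrow> D (y, z) \<longrightarrow> E (v, z)"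
    "\<forall>x y. D (x, y) \<longrightarrow> x \<in> S \<and> y \<in> S"
proof -
  obtain C where C: "eventually C U" "\<forall>x y. C (x, y) \<longrightarrow> C (y, x)"
    "\<forall>x y z. C (x, y) \<longrightarrow> C (y, z) \<longrightarrow> E (x, z)" "\<forall>x y. C (x, y) \<longrightarrow> x \<in> S \<and> y \<in> S"
    by (rule uniformity_sym_half[OF U E])
  obtain D where D: "eventually D U" "\<forall>x y. D (x, y) \<longrightarrow> D (y, x)"
    "\<forall>x y z. D (x, y) \<longrightarrow> D (y, z) \<longrightarrow> C (x, z)" "\<forall>x y. D (x, y) \<longrightarrow> x \<in> S \<and> y \<in> S"
    by (rule uniformity_sym_half[OF U C(1)])
  have "\<forall>v w x y z. D (v, w) \<longrightarrow> D (w, x) \<longrightarrow> D (x, y) \<longrightarrow> D (y, z) \<longrightarrow> E (v, z)"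
    using C(3) D(3) by blast
  then show thesis
    by (rule that[OF D(1,2) _ D(4)])
qed

text \<open>The set \<open>{y. E (x, y)}\<close> need not be open, but its interior contains \<open>x\<close>. The witness \<open>W\<close>
collects the points of which \<open>{y. E (x, y)}\<close> is a neighbourhood; that \<open>W\<close> is open is where an
entourage \<open>D\<close> with \<open>D\<close> composed with \<open>D\<close> inside \<open>E\<close> is used.\<close>

lemma uniform_topology_nbhd:
  assumes U: "is_uniformity S U" and E: "eventually E U" and x: "x \<in> S"
  obtains W where "openin (uniform_topology S U) W" "x \<in> W" "\<forall>y\<in>W. E (x, y)"
proof -
  define W where "W = {y \<in> S. eventually (\<lambda>(a, b). a = y \<longrightarrow> E (x, b)) U}"
  have "openin (uniform_topology S U) W"
    unfolding openin_uniform_topology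
  proof (intro conjI ballI)
    show "W \<subseteq> S" by (auto simp: W_def)
    fix y assume "y \<in> W"
    then have "eventually (\<lambda>(a, b). a = y \<longrightarrow> E (x, b)) U" by (simp add: W_def)
    then obtain D where D: "eventually D U" "\<forall>a b. D (a, b) \<longrightarrow> D (b, a)"
      "\<forall>a b c. D (a, b) \<longrightarrow> D (b, c) \<longrightarrow> (case (a, c) of (a, b) \<Rightarrow> a = y \<longrightarrow> E (x, b))"
      "\<forall>a b. D (a, b) \<longrightarrow> a \<in> S \<and> b \<in> S"
      by (rule uniformity_sym_half[OF U])
    have "z \<in> W" if "D (y, z)" for z
    proof -
      have "eventually (\<lambda>(a, b). a = z \<longrightarrow> E (x, b)) U"
        using D(1) by eventually_elim (use D(3) that in auto)
      then show ?thesis using D(4) that by (auto simp: W_def)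
    qed
    then show "eventually (\<lambda>(x', z). x' = y \<longrightarrow> z \<in> W) U"
      using D(1) by (auto elim!: eventually_mono)
  qed
  moreover have "x \<in> W"
    using E x by (auto simp: W_def elim!: eventually_mono)
  moreover have "E (x, y)" if "y \<in> W" for y
    using that uniformity_refl[OF U, of _ y] unfolding W_def by force
  ultimately show thesis by (intro that[of W]) auto
qed

section \<open>The universal uniformity\<close>

text \<open>The uniformities whose topology is coarser than or equal to that of \<open>X\<close>. This class is closed
under suprema and contains every uniformity induced by a continuous real function, whereas
it is not obvious that any compatible uniformity exists.\<close>

definition admissible_uniformity :: "'a topology \<Rightarrow> ('a \<times> 'a) filter \<Rightarrow> bool" where
  "admissible_uniformity X U \<longleftrightarrow>
     is_uniformity (topspace X) U \<and>
     (\<forall>E. eventually E U \<longrightarrow> (\<forall>x\<in>topspace X. \<exists>W. openin X W \<and> x \<in> W \<and> (\<forall>y\<in>W. E (x, y))))"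

lemma compatible_imp_admissible:
  assumes "is_uniformity (topspace X) U" "uniform_topology (topspace X) U = X"
  shows "admissible_uniformity X U"
  unfolding admissible_uniformity_def
proof (intro conjI allI impI ballI)
  fix E x assume "eventually E U" "x \<in> topspace X"
  then obtain W where "openin (uniform_topology (topspace X) U) W" "x \<in> W"
    "\<forall>y\<in>W. E (x, y)"
    by (rule uniform_topology_nbhd[OF assms(1)])
  then show "\<exists>W. openin X W \<and> x \<in> W \<and> (\<forall>y\<in>W. E (x, y))"
    unfolding assms(2) by blast
qed (rule assms(1))

lemma admissible_imp_coarser:
  assumes U: "admissible_uniformity X U" and W: "openin (uniform_topology (topspace X) U) W"
  shows "openin X W"
proof (subst openin_subopen, intro ballI)
  fix x assume x: "x \<in> W"
  then have "eventually (\<lambda>(x', y). x' = x \<longrightarrow> y \<in> W) U" "x \<in> topspace X"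
    using W by (auto simp: openin_uniform_topology)
  with U have "\<exists>T. openin X T \<and> x \<in> T \<and> (\<forall>y\<in>T. (case (x, y) of (x', y) \<Rightarrow> x' = x \<longrightarrow> y \<in> W))"
    unfolding admissible_uniformity_def by blast
  then show "\<exists>T. openin X T \<and> x \<in> T \<and> T \<subseteq> W" by auto
qed

lemma admissible_principal: "admissible_uniformity X (principal (topspace X \<times> topspace X))"
  unfolding admissible_uniformity_def is_uniformity_def eventually_principal
proof (intro conjI allI impI)
  fix E :: "'a \<times> 'a \<Rightarrow> bool" assume E: "\<forall>p\<in>topspace X \<times> topspace X. E p"
  then show "\<forall>x\<in>topspace X. E (x, x)"
    "\<forall>p\<in>topspace X \<times> topspace X. case p of (x, y) \<Rightarrow> E (y, x)" by auto
  show "\<exists>D. (\<forall>p\<in>topspace X \<times> topspace X. D p) \<and> (\<forall>x y z. D (x, y) \<longrightarrow> D (y, z) \<longrightarrow> E (x, z))"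
    using E by (intro exI[of _ "\<lambda>p. p \<in> topspace X \<times> topspace X"]) auto
  show "\<forall>x\<in>topspace X. \<exists>W. openin X W \<and> x \<in> W \<and> (\<forall>y\<in>W. E (x, y))"
    using E by (intro ballI exI[of _ "topspace X"]) auto
qed simp

text \<open>Finer uniformities are smaller filters, so the infimum of filters is the supremum of
uniformities.\<close>

lemma is_uniformity_inf:
  assumes U: "is_uniformity S U" and V: "is_uniformity S V"
  shows "is_uniformity S (inf U V)"
  unfolding is_uniformity_def
proof (intro conjI allI impI)
  show "inf U V \<le> principal (S \<times> S)"
    using U by (auto simp: is_uniformity_def le_infI1)
  fix E assume "eventually E (inf U V)"
  then obtain P Q where PQ: "eventually P U" "eventually Q V" "\<And>p. P p \<Longrightarrow> Q p \<Longrightarrow> E p"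
    unfolding eventually_inf by blast
  obtain P' where P': "eventually P' U" "\<forall>x y. P' (x, y) \<longrightarrow> P' (y, x)"
    "\<forall>x y z. P' (x, y) \<longrightarrow> P' (y, z) \<longrightarrow> P (x, z)" "\<forall>x y. P' (x, y) \<longrightarrow> x \<in> S \<and> y \<in> S"
    by (rule uniformity_sym_half[OF U PQ(1)])
  obtain Q' where Q': "eventually Q' V" "\<forall>x y. Q' (x, y) \<longrightarrow> Q' (y, x)"
    "\<forall>x y z. Q' (x, y) \<longrightarrow> Q' (y, z) \<longrightarrow> Q (x, z)" "\<forall>x y. Q' (x, y) \<longrightarrow> x \<in> S \<and> y \<in> S"
    by (rule uniformity_sym_half[OF V PQ(2)])
  show "\<forall>x\<in>S. E (x, x)"
    using uniformity_refl[OF U PQ(1)] uniformity_refl[OF V PQ(2)] PQ(3) by blast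
  have D: "eventually (\<lambda>p. P' p \<and> Q' p) (inf U V)"
    unfolding eventually_inf using P'(1) Q'(1) by blast
  show "\<exists>D. eventually D (inf U V) \<and> (\<forall>x y z. D (x, y) \<longrightarrow> D (y, z) \<longrightarrow> E (x, z))"
    using D P'(3) Q'(3) PQ(3) by (intro exI[of _ "\<lambda>p. P' p \<and> Q' p"]) blast
  have "eventually (\<lambda>(x, y). P (y, x)) U" "eventually (\<lambda>(x, y). Q (y, x)) V"
    using U V PQ unfolding is_uniformity_def by blast+
  then show "eventually (\<lambda>(x, y). E (y, x)) (inf U V)"
    unfolding eventually_inf using PQ(3) by (intro exI conjI) auto
qed

lemma admissible_inf:
  assumes "admissible_uniformity X U" "admissible_uniformity X V"
  shows "admissible_uniformity X (inf U V)"
  unfolding admissible_uniformity_def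
proof (intro conjI allI impI ballI)
  show "is_uniformity (topspace X) (inf U V)"
    using assms by (auto simp: admissible_uniformity_def intro: is_uniformity_inf)
  fix E x assume "eventually E (inf U V)" and x: "x \<in> topspace X"
  then obtain P Q where PQ: "eventually P U" "eventually Q V" "\<And>p. P p \<Longrightarrow> Q p \<Longrightarrow> E p"
    unfolding eventually_inf by blast
  obtain T where T: "openin X T" "x \<in> T" "\<forall>y\<in>T. P (x, y)"
    using assms(1) PQ(1) x unfolding admissible_uniformity_def by blast
  obtain T' where T': "openin X T'" "x \<in> T'" "\<forall>y\<in>T'. Q (x, y)"
    using assms(2) PQ(2) x unfolding admissible_uniformity_def by blast
  have "openin X (T \<inter> T')" "x \<in> T \<inter> T'" "\<forall>y\<in>T \<inter> T'. E (x, y)"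
    using T T' PQ(3) by auto
  then show "\<exists>W. openin X W \<and> x \<in> W \<and> (\<forall>y\<in>W. E (x, y))" by blast
qed

text \<open>The supremum of all admissible uniformities. It turns out to be the universal uniformity.\<close>

definition finest_uniformity :: "'a topology \<Rightarrow> ('a \<times> 'a) filter" where
  "finest_uniformity X = Inf {U. admissible_uniformity X U}"

text \<open>Admissible uniformities are directed, so an entourage of their supremum is already an
entourage of one of them. This makes all properties of admissible uniformities pass to the
supremum.\<close>

lemma eventually_finest_uniformity:
  "eventually E (finest_uniformity X) \<longleftrightarrow> (\<exists>U. admissible_uniformity X U \<and> eventually E U)"
proof -
  have "eventually E (finest_uniformity X) \<longleftrightarrow>
      (\<exists>U\<in>{U. admissible_uniformity X U}. eventually E U)"
    unfolding finest_uniformity_def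
  proof (rule eventually_Inf_base)
    show "{U. admissible_uniformity X U} \<noteq> {}"
      using admissible_principal by blast
  qed (use admissible_inf in blast)
  then show ?thesis by blast
qed

lemma finest_uniformity_admissible: "admissible_uniformity X (finest_uniformity X)"
  unfolding admissible_uniformity_def is_uniformity_def
proof (intro conjI allI impI)
  show "finest_uniformity X \<le> principal (topspace X \<times> topspace X)"
    unfolding finest_uniformity_def using admissible_principal by (intro Inf_lower) simp
next
  fix E assume "eventually E (finest_uniformity X)"
  then obtain U where U: "admissible_uniformity X U" "eventually E U"
    by (auto simp: eventually_finest_uniformity)
  then show "\<forall>x\<in>topspace X. E (x, x)"
    "\<forall>x\<in>topspace X. \<exists>W. openin X W \<and> x \<in> W \<and> (\<forall>y\<in>W. E (x, y))"
    by (auto simp: admissible_uniformity_def is_uniformity_def)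
  have "eventually (\<lambda>(x, y). E (y, x)) U"
    "\<exists>D. eventually D U \<and> (\<forall>x y z. D (x, y) \<longrightarrow> D (y, z) \<longrightarrow> E (x, z))"
    using U by (auto simp: admissible_uniformity_def is_uniformity_def)
  then show "eventually (\<lambda>(x, y). E (y, x)) (finest_uniformity X)"
    "\<exists>D. eventually D (finest_uniformity X) \<and> (\<forall>x y z. D (x, y) \<longrightarrow> D (y, z) \<longrightarrow> E (x, z))"
    using U(1) unfolding eventually_finest_uniformity by blast+
qed

text \<open>The coarsest uniformity on \<open>S\<close> making \<open>f\<close> uniformly continuous.\<close>

definition pullback_uniformity :: "'a set \<Rightarrow> ('a \<Rightarrow> real) \<Rightarrow> ('a \<times> 'a) filter" where
  "pullback_uniformity S f = inf (filtercomap (map_prod f f) uniformity) (principal (S \<times> S))"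

lemma eventually_pullback_uniformity:
  "eventually E (pullback_uniformity S f) \<longleftrightarrow>
     (\<exists>e>0. \<forall>x\<in>S. \<forall>y\<in>S. dist (f x) (f y) < e \<longrightarrow> E (x, y))"
  unfolding pullback_uniformity_def eventually_inf_principal eventually_filtercomap
    eventually_uniformity_metric
proof safe
  fix Q and e :: real
  assume "\<forall>x. Q (map_prod f f x) \<longrightarrow> x \<in> S \<times> S \<longrightarrow> E x" "0 < e"
    "\<forall>x y. dist x y < e \<longrightarrow> Q (x, y)"
  then show "\<exists>e>0. \<forall>x\<in>S. \<forall>y\<in>S. dist (f x) (f y) < e \<longrightarrow> E (x, y)"
    by (intro exI[of _ e]) auto
next
  fix e :: real
  assume "0 < e" "\<forall>x\<in>S. \<forall>y\<in>S. dist (f x) (f y) < e \<longrightarrow> E (x, y)"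
  then show "\<exists>Q. (\<exists>e>0. \<forall>x y. dist x y < e \<longrightarrow> Q (x, y)) \<and>
      (\<forall>x. Q (map_prod f f x) \<longrightarrow> x \<in> S \<times> S \<longrightarrow> E x)"
    by (intro exI[of _ "\<lambda>(a, b). dist a b < e"]) auto
qed

lemma pullback_uniformity_admissible:
  assumes f: "continuous_map X euclideanreal f"
  shows "admissible_uniformity X (pullback_uniformity (topspace X) f)"
  unfolding admissible_uniformity_def is_uniformity_def
proof (intro conjI allI impI)
  show "pullback_uniformity (topspace X) f \<le> principal (topspace X \<times> topspace X)"
    by (simp add: pullback_uniformity_def)
next
  fix E assume "eventually E (pullback_uniformity (topspace X) f)"
  then obtain e where e: "e > 0"
    "\<And>x y. x \<in> topspace X \<Longrightarrow> y \<in> topspace X \<Longrightarrow> dist (f x) (f y) < e \<Longrightarrow> E (x, y)"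
    by (auto simp: eventually_pullback_uniformity)
  show "\<forall>x\<in>topspace X. E (x, x)" using e by simp
  show "eventually (\<lambda>(x, y). E (y, x)) (pullback_uniformity (topspace X) f)"
    using e unfolding eventually_pullback_uniformity by (metis case_prod_conv dist_commute)
  define D where "D = (\<lambda>(x, y). x \<in> topspace X \<and> y \<in> topspace X \<and> dist (f x) (f y) < e / 2)"
  have "eventually D (pullback_uniformity (topspace X) f)"
    unfolding eventually_pullback_uniformity D_def using e(1) by (intro exI[of _ "e / 2"]) auto
  moreover have "E (x, z)" if "D (x, y)" "D (y, z)" for x y z
  proof (rule e(2))
    have "dist (f x) (f y) < e / 2" "dist (f y) (f z) < e / 2"
      using that by (simp_all add: D_def)
    then show "dist (f x) (f z) < e"
      using dist_triangle[of "f x" "f z" "f y"] by linarith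
    show "x \<in> topspace X" "z \<in> topspace X"
      using that by (simp_all add: D_def)
  qed
  ultimately show "\<exists>D. eventually D (pullback_uniformity (topspace X) f) \<and>
      (\<forall>x y z. D (x, y) \<longrightarrow> D (y, z) \<longrightarrow> E (x, z))" by blast
  show "\<forall>x\<in>topspace X. \<exists>W. openin X W \<and> x \<in> W \<and> (\<forall>y\<in>W. E (x, y))"
  proof
    fix x assume x: "x \<in> topspace X"
    have "openin X {y \<in> topspace X. f y \<in> ball (f x) e}"
      using f by (rule openin_continuous_map_preimage) simp
    then show "\<exists>W. openin X W \<and> x \<in> W \<and> (\<forall>y\<in>W. E (x, y))"
      using e x by (intro exI[of _ "{y \<in> topspace X. f y \<in> ball (f x) e}"]) auto
  qed
qed

lemma finest_uniformity_continuous_real: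
  assumes "continuous_map X euclideanreal f" "e > 0"
  shows "eventually (\<lambda>(x, y). dist (f x) (f y) < e) (finest_uniformity X)"
  unfolding eventually_finest_uniformity
proof (intro exI conjI)
  show "admissible_uniformity X (pullback_uniformity (topspace X) f)"
    by (rule pullback_uniformity_admissible[OF assms(1)])
  show "eventually (\<lambda>(x, y). dist (f x) (f y) < e) (pullback_uniformity (topspace X) f)"
    unfolding eventually_pullback_uniformity using assms(2) by (intro exI[of _ e]) simp
qed

text \<open>Complete regularity enters here: an open set \<open>W\<close> around \<open>x\<close> contains the ball of radius one
around \<open>x\<close> for the pseudometric of a function that separates \<open>x\<close> from the complement of \<open>W\<close>.\<close>

lemma finest_uniformity_compatible:
  assumes "completely_regular_space X"
  shows "uniform_topology (topspace X) (finest_uniformity X) = X"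
  unfolding topology_eq
proof (intro allI iffI)
  fix W assume W: "openin X W"
  show "openin (uniform_topology (topspace X) (finest_uniformity X)) W"
    unfolding openin_uniform_topology
  proof (intro conjI ballI)
    show "W \<subseteq> topspace X" using W by (rule openin_subset)
    fix x assume "x \<in> W"
    with W have "\<exists>f. continuous_map X euclideanreal f \<and> f x = 0 \<and> f ` (topspace X - W) \<subseteq> {1}"
      using assms[unfolded completely_regular_space_alt'] by simp
    then obtain f where f: "continuous_map X euclideanreal f" "f x = 0"
      "f ` (topspace X - W) \<subseteq> {1}" by (elim exE conjE)
    from uniformity_subset finest_uniformity_admissible
    have "eventually (\<lambda>p. p \<in> topspace X \<times> topspace X) (finest_uniformity X)"
      unfolding admissible_uniformity_def by blast
    then show "eventually (\<lambda>(x', y). x' = x \<longrightarrow> y \<in> W) (finest_uniformity X)"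
      using finest_uniformity_continuous_real[OF f(1) zero_less_one]
      by eventually_elim (use f(2,3) in \<open>fastforce simp: image_subset_iff\<close>)
  qed
qed (rule admissible_imp_coarser[OF finest_uniformity_admissible])

text \<open>The finest admissible uniformity is itself compatible, hence it is the finest compatible one,
and the least filter in the definition exists.\<close>

lemma universal_uniformity_eq:
  assumes "completely_regular_space X"
  shows "universal_uniformity X = finest_uniformity X"
  unfolding universal_uniformity_def
proof (rule Least_equality)
  show "is_uniformity (topspace X) (finest_uniformity X) \<and>
      uniform_topology (topspace X) (finest_uniformity X) = X"
    using finest_uniformity_admissible finest_uniformity_compatible[OF assms]
    by (auto simp: admissible_uniformity_def)
  fix U assume "is_uniformity (topspace X) U \<and> uniform_topology (topspace X) U = X"
  then have "admissible_uniformity X U"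
    by (elim conjE) (rule compatible_imp_admissible)
  then show "finest_uniformity X \<le> U"
    unfolding finest_uniformity_def by (intro Inf_lower) simp
qed

section \<open>Total boundedness\<close>

text \<open>Covers by small sets replace covers by balls centred in \<open>S\<close>: they pass to subsets, images and
preimages without any choice of new centres.\<close>

definition totally_bounded_in :: "('a \<times> 'a) filter \<Rightarrow> 'a set \<Rightarrow> bool" where
  "totally_bounded_in U S \<longleftrightarrow>
     (\<forall>E. eventually E U \<longrightarrow>
        (\<exists>\<C>. finite \<C> \<and> S \<subseteq> \<Union>\<C> \<and> (\<forall>C\<in>\<C>. \<forall>x\<in>C. \<forall>y\<in>C. E (x, y))))"

lemma totally_bounded_inE:
  assumes "totally_bounded_in U S" "eventually E U"
  obtains \<C> where "finite \<C>" "S \<subseteq> \<Union>\<C>" "\<forall>C\<in>\<C>. \<forall>x\<in>C. \<forall>y\<in>C. E (x, y)"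
proof -
  have "\<exists>\<C>. finite \<C> \<and> S \<subseteq> \<Union>\<C> \<and> (\<forall>C\<in>\<C>. \<forall>x\<in>C. \<forall>y\<in>C. E (x, y))"
    using assms by (simp add: totally_bounded_in_def)
  then show thesis by (elim exE conjE) (rule that)
qed

lemma compactin_imp_totally_bounded:
  assumes V: "is_uniformity M V" and K: "compactin (uniform_topology M V) K"
  shows "totally_bounded_in V K"
  unfolding totally_bounded_in_def
proof (intro allI impI)
  fix E assume "eventually E V"
  then obtain D where D: "eventually D V" "\<forall>x y. D (x, y) \<longrightarrow> D (y, x)"
    "\<forall>x y z. D (x, y) \<longrightarrow> D (y, z) \<longrightarrow> E (x, z)" "\<forall>x y. D (x, y) \<longrightarrow> x \<in> M \<and> y \<in> M"
    by (rule uniformity_sym_half[OF V])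
  define \<O> where "\<O> = {W. openin (uniform_topology M V) W \<and> (\<forall>x\<in>W. \<forall>y\<in>W. E (x, y))}"
  have "K \<subseteq> \<Union>\<O>"
  proof
    fix x assume "x \<in> K"
    then have "x \<in> M"
      using compactin_subset_topspace[OF K] topspace_uniform_topology[OF V] by blast
    then obtain W where W: "openin (uniform_topology M V) W" "x \<in> W" "\<forall>y\<in>W. D (x, y)"
      by (rule uniform_topology_nbhd[OF V D(1)])
    then have "W \<in> \<O>"
      using D(2,3) unfolding \<O>_def by blast
    with W(2) show "x \<in> \<Union>\<O>" by blast
  qed
  moreover have "\<And>W. W \<in> \<O> \<Longrightarrow> openin (uniform_topology M V) W" by (simp add: \<O>_def)
  ultimately have "\<exists>\<C>. finite \<C> \<and> \<C> \<subseteq> \<O> \<and> K \<subseteq> \<Union>\<C>"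
    by (intro compactinD[OF K])
  then obtain \<C> where C: "finite \<C>" "\<C> \<subseteq> \<O>" "K \<subseteq> \<Union>\<C>" by (elim exE conjE)
  have "\<forall>C\<in>\<C>. \<forall>x\<in>C. \<forall>y\<in>C. E (x, y)"
    using C(2) by (auto simp: \<O>_def)
  with C(1,3) show "\<exists>\<C>. finite \<C> \<and> K \<subseteq> \<Union>\<C> \<and> (\<forall>C\<in>\<C>. \<forall>x\<in>C. \<forall>y\<in>C. E (x, y))"
    by (intro exI conjI)
qed

lemma totally_bounded_in_subset:
  assumes "totally_bounded_in U S" "T \<subseteq> S"
  shows "totally_bounded_in U T"
  unfolding totally_bounded_in_def
proof (intro allI impI)
  fix E assume "eventually E U"
  then obtain \<C> where "finite \<C>" "S \<subseteq> \<Union>\<C>" "\<forall>C\<in>\<C>. \<forall>x\<in>C. \<forall>y\<in>C. E (x, y)"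
    by (rule totally_bounded_inE[OF assms(1)])
  with assms(2) show "\<exists>\<C>. finite \<C> \<and> T \<subseteq> \<Union>\<C> \<and> (\<forall>C\<in>\<C>. \<forall>x\<in>C. \<forall>y\<in>C. E (x, y))"
    by (intro exI[of _ \<C>] conjI) auto
qed

lemma totally_bounded_in_filtercomap:
  assumes "totally_bounded_in V (j ` S)"
  shows "totally_bounded_in (filtercomap (map_prod j j) V) S"
  unfolding totally_bounded_in_def
proof (intro allI impI)
  fix E assume "eventually E (filtercomap (map_prod j j) V)"
  then obtain Q where Q: "eventually Q V" "\<forall>p. Q (map_prod j j p) \<longrightarrow> E p"
    unfolding eventually_filtercomap by (elim exE conjE) (rule that)
  obtain \<C> where C: "finite \<C>" "j ` S \<subseteq> \<Union>\<C>" "\<forall>C\<in>\<C>. \<forall>x\<in>C. \<forall>y\<in>C. Q (x, y)"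
    by (rule totally_bounded_inE[OF assms Q(1)])
  have "finite ((\<lambda>C. j -` C) ` \<C>)" "S \<subseteq> \<Union>((\<lambda>C. j -` C) ` \<C>)"
    using C(1,2) by auto
  moreover have "\<forall>C\<in>(\<lambda>C. j -` C) ` \<C>. \<forall>x\<in>C. \<forall>y\<in>C. E (x, y)"
  proof safe
    fix C x y assume "C \<in> \<C>" "j x \<in> C" "j y \<in> C"
    with C(3) have "Q (map_prod j j (x, y))" by simp
    with Q(2) show "E (x, y)" by blast
  qed
  ultimately show "\<exists>\<C>. finite \<C> \<and> S \<subseteq> \<Union>\<C> \<and> (\<forall>C\<in>\<C>. \<forall>x\<in>C. \<forall>y\<in>C. E (x, y))"
    by (intro exI conjI)
qed

lemma totally_bounded_in_inf_principal:
  assumes "totally_bounded_in U S" "S \<subseteq> T"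
  shows "totally_bounded_in (inf U (principal (T \<times> T))) S"
  unfolding totally_bounded_in_def
proof (intro allI impI)
  fix E assume "eventually E (inf U (principal (T \<times> T)))"
  then have "eventually (\<lambda>p. p \<in> T \<times> T \<longrightarrow> E p) U"
    by (simp add: eventually_inf_principal)
  then obtain \<C> where C: "finite \<C>" "S \<subseteq> \<Union>\<C>"
    "\<forall>C\<in>\<C>. \<forall>x\<in>C. \<forall>y\<in>C. (x, y) \<in> T \<times> T \<longrightarrow> E (x, y)"
    by (rule totally_bounded_inE[OF assms(1)])
  have "finite ((\<lambda>C. C \<inter> S) ` \<C>)" "S \<subseteq> \<Union>((\<lambda>C. C \<inter> S) ` \<C>)"
    using C(1,2) by auto
  moreover have "\<forall>C\<in>(\<lambda>C. C \<inter> S) ` \<C>. \<forall>x\<in>C. \<forall>y\<in>C. E (x, y)"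
    using C(3) assms(2) by auto
  ultimately show "\<exists>\<C>. finite \<C> \<and> S \<subseteq> \<Union>\<C> \<and> (\<forall>C\<in>\<C>. \<forall>x\<in>C. \<forall>y\<in>C. E (x, y))"
    by (intro exI conjI)
qed

lemma totally_bounded_in_image:
  assumes "totally_bounded_in (inf (filtercomap (map_prod j j) V) (principal (T \<times> T))) S"
  shows "totally_bounded_in V (j ` S)"
  unfolding totally_bounded_in_def
proof (intro allI impI)
  fix E assume "eventually E V"
  then have "eventually (\<lambda>p. E (map_prod j j p)) (filtercomap (map_prod j j) V)"
    by (rule eventually_filtercomapI)
  then have "eventually (\<lambda>p. E (map_prod j j p))
      (inf (filtercomap (map_prod j j) V) (principal (T \<times> T)))"
    unfolding eventually_inf_principal by (rule eventually_mono) simp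
  then obtain \<C> where C: "finite \<C>" "S \<subseteq> \<Union>\<C>" "\<forall>C\<in>\<C>. \<forall>x\<in>C. \<forall>y\<in>C. E (map_prod j j (x, y))"
    by (rule totally_bounded_inE[OF assms])
  have "finite ((`) j ` \<C>)" "j ` S \<subseteq> \<Union>((`) j ` \<C>)"
    using C(1,2) by auto
  moreover have "\<forall>C\<in>(`) j ` \<C>. \<forall>x\<in>C. \<forall>y\<in>C. E (x, y)"
    using C(3) by auto
  ultimately show "\<exists>\<C>. finite \<C> \<and> j ` S \<subseteq> \<Union>\<C> \<and> (\<forall>C\<in>\<C>. \<forall>x\<in>C. \<forall>y\<in>C. E (x, y))"
    by (intro exI conjI)
qed

text \<open>A point of the closure of a \<open>D\<close>-small set is \<open>D\<close>-close to the set, so the closure is small of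
order three, within the entourage \<open>E\<close> that contains the fourfold composition of \<open>D\<close>.\<close>

lemma totally_bounded_in_closure:
  assumes V: "is_uniformity M V" and S: "totally_bounded_in V S"
  shows "totally_bounded_in V (uniform_topology M V closure_of S)"
  unfolding totally_bounded_in_def
proof (intro allI impI)
  let ?cl = "\<lambda>C. uniform_topology M V closure_of C"
  fix E assume "eventually E V"
  then obtain D where D: "eventually D V" "\<forall>x y. D (x, y) \<longrightarrow> D (y, x)"
    "\<forall>v w x y z. D (v, w) \<longrightarrow> D (w, x) \<longrightarrow> D (x, y) \<longrightarrow> D (y, z) \<longrightarrow> E (v, z)"
    "\<forall>x y. D (x, y) \<longrightarrow> x \<in> M \<and> y \<in> M"
    by (rule uniformity_sym_quarter[OF V])
  obtain \<C> where C: "finite \<C>" "S \<subseteq> \<Union>\<C>" "\<forall>C\<in>\<C>. \<forall>x\<in>C. \<forall>y\<in>C. D (x, y)"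
    by (rule totally_bounded_inE[OF S D(1)])
  have near: "\<exists>c\<in>C. D (x, c)" if x: "x \<in> ?cl C" for x C
  proof -
    have "x \<in> M"
      using x topspace_uniform_topology[OF V] by (auto simp: in_closure_of)
    then obtain W where W: "openin (uniform_topology M V) W" "x \<in> W" "\<forall>y\<in>W. D (x, y)"
      by (rule uniform_topology_nbhd[OF V D(1)])
    obtain c where "c \<in> C" "c \<in> W"
      using x W(1,2) unfolding in_closure_of by blast
    with W(3) show ?thesis by blast
  qed
  have "?cl S \<subseteq> ?cl (\<Union>\<C>)"
    by (rule closure_of_mono[OF C(2)])
  also have "\<dots> = \<Union>(?cl ` \<C>)"
    by (rule closure_of_Union[OF C(1)])
  finally have "?cl S \<subseteq> \<Union>(?cl ` \<C>)" .
  moreover have "\<forall>C'\<in>?cl ` \<C>. \<forall>x\<in>C'. \<forall>y\<in>C'. E (x, y)"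
  proof safe
    fix C x y assume A: "C \<in> \<C>" "x \<in> ?cl C" "y \<in> ?cl C"
    obtain c c' where c: "c \<in> C" "D (x, c)" "c' \<in> C" "D (y, c')"
      using near A(2,3) by blast
    then have "D (c, c')" "D (c', y)" "D (y, y)"
      using C(3) A(1) D(2,4) uniformity_refl[OF V D(1)] by blast+
    with c(2) D(3) show "E (x, y)" by blast
  qed
  ultimately show "\<exists>\<C>. finite \<C> \<and> ?cl S \<subseteq> \<Union>\<C> \<and> (\<forall>C\<in>\<C>. \<forall>x\<in>C. \<forall>y\<in>C. E (x, y))"
    using C(1) by (intro exI[of _ "?cl ` \<C>"]) simp
qed

section \<open>Ultrafilters and compactness\<close>

text \<open>A minimal proper filter below \<open>F\<close>, found by Zorn's lemma, decides every predicate: if it did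
not force \<open>\<not> P\<close>, restricting it to \<open>P\<close> would give a smaller proper filter.\<close>

lemma filter_finer_ultrafilter:
  assumes "F \<noteq> bot"
  obtains G where "G \<noteq> bot" "G \<le> F" "\<forall>P. eventually P G \<or> eventually (\<lambda>x. \<not> P x) G"
proof -
  define A where "A = {G. G \<noteq> bot \<and> G \<le> F}"
  have "\<exists>m\<in>A. \<forall>a\<in>A. a \<le> m \<longrightarrow> a = m"
  proof (rule predicate_Zorn)
    show "partial_order_on A (relation_of (\<lambda>x y. y \<le> x) A)"
      by (rule partial_order_on_relation_ofI) auto
    fix C assume C: "C \<in> Chains (relation_of (\<lambda>x y. y \<le> x) A)"
    then have CA: "C \<subseteq> A" and chain: "\<forall>a\<in>C. \<forall>b\<in>C. a \<le> b \<or> b \<le> a"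
      by (auto simp: Chains_def relation_of_def)
    show "\<exists>u\<in>A. \<forall>a\<in>C. u \<le> a"
    proof (cases "C = {}")
      case True
      then show ?thesis using assms by (auto simp: A_def)
    next
      case False
      have "eventually P (Inf C) \<longleftrightarrow> (\<exists>b\<in>C. eventually P b)" for P
        using False by (rule eventually_Inf_base) (use chain in \<open>metis inf.orderE inf_commute order_refl\<close>)
      then have "Inf C \<noteq> bot"
        using CA unfolding trivial_limit_def A_def by blast
      moreover have "Inf C \<le> F"
        using False CA by (auto simp: A_def intro: Inf_lower2)
      ultimately show ?thesis
        by (intro bexI[of _ "Inf C"]) (auto simp: A_def Inf_lower)
    qed
  qed
  then obtain G where G: "G \<in> A" "\<And>H. H \<in> A \<Longrightarrow> H \<le> G \<Longrightarrow> H = G" by blast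
  have "eventually P G \<or> eventually (\<lambda>x. \<not> P x) G" for P
  proof (cases "inf G (principal {x. P x}) = bot")
    case True
    then have "eventually (\<lambda>x. x \<in> {x. P x} \<longrightarrow> False) G"
      unfolding trivial_limit_def eventually_inf_principal by simp
    then show ?thesis by simp
  next
    case False
    then have "inf G (principal {x. P x}) = G"
      using G(1) by (intro G(2)) (auto simp: A_def intro: le_infI1)
    then have "G \<le> principal {x. P x}" by (metis inf.cobounded2)
    then show ?thesis by (simp add: le_principal)
  qed
  with G(1) show thesis by (intro that[of G]) (auto simp: A_def)
qed

text \<open>A family of closed sets with the finite intersection property on \<open>K\<close> generates a filter; an
ultrafilter below it contains a small set from every finite cover by small sets, so it is
Cauchy, and its limit lies in all members of the family.\<close>

lemma complete_totally_bounded_imp_compactin: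
  assumes V: "is_uniformity M V" and complete: "complete_uniformity M V"
    and K: "closedin (uniform_topology M V) K" "totally_bounded_in V K"
  shows "compactin (uniform_topology M V) K"
  unfolding compactin_fip
proof (intro conjI allI impI)
  let ?T = "uniform_topology M V"
  show "K \<subseteq> topspace ?T" using K(1) by (rule closedin_subset)
  fix \<U> assume "(\<forall>C\<in>\<U>. closedin ?T C) \<and> (\<forall>\<F>. finite \<F> \<and> \<F> \<subseteq> \<U> \<longrightarrow> K \<inter> \<Inter>\<F> \<noteq> {})"
  then have closed: "\<And>C. C \<in> \<U> \<Longrightarrow> closedin ?T C"
    and fip: "\<And>\<F>. finite \<F> \<Longrightarrow> \<F> \<subseteq> \<U> \<Longrightarrow> K \<inter> \<Inter>\<F> \<noteq> {}" by auto
  define F where "F = (INF \<F>\<in>{\<F>. finite \<F> \<and> \<F> \<subseteq> \<U>}. principal (K \<inter> \<Inter>\<F>))"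
  have ev: "eventually P F \<longleftrightarrow> (\<exists>\<F>\<in>{\<F>. finite \<F> \<and> \<F> \<subseteq> \<U>}. eventually P (principal (K \<inter> \<Inter>\<F>)))" for P
    unfolding F_def
  proof (rule eventually_INF_base)
    fix A B assume "A \<in> {\<F>. finite \<F> \<and> \<F> \<subseteq> \<U>}" "B \<in> {\<F>. finite \<F> \<and> \<F> \<subseteq> \<U>}"
    then show "\<exists>\<F>\<in>{\<F>. finite \<F> \<and> \<F> \<subseteq> \<U>}. principal (K \<inter> \<Inter>\<F>) \<le>
        inf (principal (K \<inter> \<Inter>A)) (principal (K \<inter> \<Inter>B))"
      by (intro bexI[of _ "A \<union> B"]) auto
  qed auto
  have "F \<noteq> bot"
    unfolding trivial_limit_def ev eventually_principal using fip by blast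
  then obtain G where G: "G \<noteq> bot" "G \<le> F" "\<forall>P. eventually P G \<or> eventually (\<lambda>x. \<not> P x) G"
    by (rule filter_finer_ultrafilter)
  have evG: "eventually (\<lambda>x. x \<in> K \<inter> \<Inter>\<F>) G" if "finite \<F>" "\<F> \<subseteq> \<U>" for \<F>
  proof (rule filter_leD[OF G(2)])
    show "eventually (\<lambda>x. x \<in> K \<inter> \<Inter>\<F>) F"
      unfolding ev eventually_principal using that by blast
  qed
  have evK: "eventually (\<lambda>x. x \<in> K) G"
    using evG[of "{}"] by simp
  have "K \<subseteq> M"
    using closedin_subset[OF K(1)] topspace_uniform_topology[OF V] by simp
  then have "G \<le> principal M"
    using evK by (auto simp: le_principal elim: eventually_mono)
  moreover have "G \<times>\<^sub>F G \<le> V"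
  proof (rule filter_leI)
    fix E assume "eventually E V"
    then obtain \<C> where C: "finite \<C>" "K \<subseteq> \<Union>\<C>" "\<forall>C\<in>\<C>. \<forall>x\<in>C. \<forall>y\<in>C. E (x, y)"
      by (rule totally_bounded_inE[OF K(2)])
    have "\<exists>C\<in>\<C>. eventually (\<lambda>x. x \<in> C) G"
    proof (rule ccontr)
      assume "\<not> ?thesis"
      then have "\<forall>C\<in>\<C>. eventually (\<lambda>x. x \<notin> C) G" using G(3) by blast
      then have "eventually (\<lambda>x. \<forall>C\<in>\<C>. x \<notin> C) G"
        using C(1) by (simp add: eventually_ball_finite)
      with evK have "eventually (\<lambda>x. False) G"
        by eventually_elim (use C(2) in blast)
      with G(1) show False by (simp add: trivial_limit_def)
    qed
    then obtain C where "C \<in> \<C>" "eventually (\<lambda>x. x \<in> C) G" by blast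
    with C(3) show "eventually E (G \<times>\<^sub>F G)"
      unfolding eventually_prod_filter
      by (intro exI[of _ "\<lambda>x. x \<in> C"]) auto
  qed
  ultimately obtain y where y: "y \<in> M" "G \<le> nhdsin ?T y"
    using complete G(1) unfolding complete_uniformity_def by blast
  have in_closed: "y \<in> C" if C: "closedin ?T C" "eventually (\<lambda>x. x \<in> C) G" for C
  proof (rule ccontr)
    assume "y \<notin> C"
    with y(1) have "y \<in> topspace ?T - C"
      using topspace_uniform_topology[OF V] by auto
    moreover have "openin ?T (topspace ?T - C)"
      using C(1) by (rule openin_diff[OF openin_topspace])
    ultimately have "eventually (\<lambda>x. x \<in> topspace ?T - C) (nhdsin ?T y)"
      unfolding eventually_nhdsin by blast
    then have "eventually (\<lambda>x. x \<in> topspace ?T - C) G"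
      by (rule filter_leD[OF y(2)])
    with C(2) have "eventually (\<lambda>x. False) G" by eventually_elim simp
    with G(1) show False by (simp add: trivial_limit_def)
  qed
  have "y \<in> C" if "C \<in> \<U>" for C
  proof (rule in_closed[OF closed[OF that]])
    have "eventually (\<lambda>x. x \<in> K \<inter> \<Inter>{C}) G"
      using that by (intro evG) auto
    then show "eventually (\<lambda>x. x \<in> C) G" by (simp add: eventually_conj_iff)
  qed
  moreover have "y \<in> K" by (rule in_closed[OF K(1) evK])
  ultimately show "K \<inter> \<Inter>\<U> \<noteq> {}" by blast
qed

section \<open>Functionally bounded sets\<close>

lemma functionally_bounded_if_totally_bounded:
  assumes S: "S \<subseteq> topspace X" and tb: "totally_bounded_in (finest_uniformity X) S"
  shows "functionally_bounded_in X S"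
  unfolding functionally_bounded_in_def
proof (intro conjI allI impI S)
  fix f assume "continuous_map X euclideanreal f"
  then have "eventually (\<lambda>(x, y). dist (f x) (f y) < 1) (finest_uniformity X)"
    by (rule finest_uniformity_continuous_real) simp
  then obtain \<C> where C: "finite \<C>" "S \<subseteq> \<Union>\<C>"
    "\<forall>C\<in>\<C>. \<forall>x\<in>C. \<forall>y\<in>C. case (x, y) of (x, y) \<Rightarrow> dist (f x) (f y) < 1"
    by (rule totally_bounded_inE[OF tb])
  have "bounded (f ` C)" if "C \<in> \<C>" for C
  proof (cases "C = {}")
    case False
    then obtain c where "c \<in> C" by blast
    with C(3) that have "\<forall>x\<in>C. dist (f c) (f x) \<le> 1" by fastforce
    then show ?thesis unfolding bounded_def by auto
  qed simp
  then have "bounded (\<Union>C\<in>\<C>. f ` C)"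
    using C(1) by (intro bounded_UN) auto
  then show "bounded (f ` S)"
    by (rule bounded_subset) (use C(2) in blast)
qed

text \<open>This is the sum of the functions \<open>h k\<close> in disguise: near each point at most one of them does
not vanish, so the value of that one is selected. If all of them vanish at \<open>x\<close>, the arbitrary
index chosen still gives the correct value \<open>0\<close>.\<close>

lemma continuous_map_glue:
  fixes h :: "'i \<Rightarrow> 'a \<Rightarrow> real"
  assumes h: "\<And>k. continuous_map X euclideanreal (h k)"
    and isolated: "\<And>x. x \<in> topspace X \<Longrightarrow>
      \<exists>W m. openin X W \<and> x \<in> W \<and> (\<forall>y\<in>W. \<forall>k. h k y \<noteq> 0 \<longrightarrow> k = m)"
  shows "continuous_map X euclideanreal (\<lambda>x. h (SOME k. h k x \<noteq> 0) x)"
  unfolding continuous_map_eq_topcontinuous_at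
proof
  let ?f = "\<lambda>x. h (SOME k. h k x \<noteq> 0) x"
  fix x assume x: "x \<in> topspace X"
  obtain W m where W: "openin X W" "x \<in> W" "\<forall>y\<in>W. \<forall>k. h k y \<noteq> 0 \<longrightarrow> k = m"
    using isolated[OF x] by blast
  have eq: "?f y = h m y" if "y \<in> W" for y
  proof (cases "\<exists>k. h k y \<noteq> 0")
    case True
    then have "h (SOME k. h k y \<noteq> 0) y \<noteq> 0" by (rule someI_ex)
    with W(3) that show ?thesis by auto
  qed auto
  show "topcontinuous_at X euclideanreal ?f x"
    unfolding topcontinuous_at_def
  proof (intro conjI allI impI)
    fix T assume T: "openin euclideanreal T \<and> ?f x \<in> T"
    have "openin X {y \<in> topspace X. h m y \<in> T}"
      using h[of m] T by (intro openin_continuous_map_preimage) auto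
    then have "openin X (W \<inter> {y \<in> topspace X. h m y \<in> T})"
      using W(1) by blast
    moreover have "x \<in> W \<inter> {y \<in> topspace X. h m y \<in> T}"
      using x W(2) T eq by auto
    ultimately show "\<exists>U. openin X U \<and> x \<in> U \<and> (\<forall>y\<in>U. ?f y \<in> T)"
      using eq by (intro exI[of _ "W \<inter> {y \<in> topspace X. h m y \<in> T}"]) auto
  qed (use x in auto)
qed

lemma separated_sequence:
  assumes "\<And>F. finite F \<Longrightarrow> F \<subseteq> S \<Longrightarrow> \<exists>x\<in>S. \<forall>y\<in>F. \<not> R y x"
  obtains s :: "nat \<Rightarrow> 'a" where "\<forall>n. s n \<in> S" "\<forall>m n. m < n \<longrightarrow> \<not> R (s m) (s n)"
proof -
  have "\<exists>s. \<forall>n::nat. s n \<in> S \<and> (\<forall>m<n. \<not> R (s m) (s n))"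
  proof (rule dependent_wellorder_choice)
    fix n :: nat and s :: "nat \<Rightarrow> 'a"
    assume "\<And>m. m < n \<Longrightarrow> s m \<in> S \<and> (\<forall>k<m. \<not> R (s k) (s m))"
    then have "s ` {..<n} \<subseteq> S" by blast
    then have "\<exists>x\<in>S. \<forall>y\<in>s ` {..<n}. \<not> R y x" by (intro assms) auto
    then show "\<exists>x. x \<in> S \<and> (\<forall>m<n. \<not> R (s m) x)" by auto
  qed simp
  then obtain s :: "nat \<Rightarrow> 'a" where "\<forall>n. s n \<in> S \<and> (\<forall>m<n. \<not> R (s m) (s n))" ..
  then show thesis by (intro that[of s]) auto
qed

text \<open>If no finite cover by \<open>E\<close>-small sets exists, there is a sequence \<open>s\<close> in \<open>S\<close> whose terms are
pairwise not \<open>D\<close>-close. With the fourfold composition of \<open>B\<close> inside \<open>D\<close>, the \<open>B\<close>-balls around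
the terms form a discrete family, so bumps of height \<open>n + 1\<close> supported in them glue to a
continuous function that is unbounded on \<open>S\<close>.\<close>

lemma totally_bounded_if_functionally_bounded:
  assumes X: "completely_regular_space X" and S: "functionally_bounded_in X S"
  shows "totally_bounded_in (finest_uniformity X) S"
proof (rule ccontr)
  let ?U = "finest_uniformity X"
  have U: "is_uniformity (topspace X) ?U"
    using finest_uniformity_admissible by (auto simp: admissible_uniformity_def)
  have SX: "S \<subseteq> topspace X"
    using S by (simp add: functionally_bounded_in_def)
  assume "\<not> ?thesis"
  then obtain E where E: "eventually E ?U"
    "\<And>\<C>. finite \<C> \<Longrightarrow> S \<subseteq> \<Union>\<C> \<Longrightarrow> \<not> (\<forall>C\<in>\<C>. \<forall>x\<in>C. \<forall>y\<in>C. E (x, y))"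
    unfolding totally_bounded_in_def by blast
  obtain D where D: "eventually D ?U" "\<forall>x y. D (x, y) \<longrightarrow> D (y, x)"
    "\<forall>x y z. D (x, y) \<longrightarrow> D (y, z) \<longrightarrow> E (x, z)" "\<forall>x y. D (x, y) \<longrightarrow> x \<in> topspace X \<and> y \<in> topspace X"
    by (rule uniformity_sym_half[OF U E(1)])
  obtain B where B: "eventually B ?U" "\<forall>x y. B (x, y) \<longrightarrow> B (y, x)"
    "\<forall>v w x y z. B (v, w) \<longrightarrow> B (w, x) \<longrightarrow> B (x, y) \<longrightarrow> B (y, z) \<longrightarrow> D (v, z)"
    "\<forall>x y. B (x, y) \<longrightarrow> x \<in> topspace X \<and> y \<in> topspace X"
    by (rule uniformity_sym_quarter[OF U D(1)])
  \<comment> \<open>otherwise the finitely many sets \<open>{x. D (y, x)}\<close>, which are \<open>E\<close>-small, would cover \<open>S\<close>\<close>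
  have step: "\<exists>x\<in>S. \<forall>y\<in>F. \<not> D (y, x)" if F: "finite F" for F
  proof (rule ccontr)
    assume "\<not> ?thesis"
    then have "S \<subseteq> \<Union>((\<lambda>y. {x. D (y, x)}) ` F)" by blast
    moreover have "\<forall>C\<in>(\<lambda>y. {x. D (y, x)}) ` F. \<forall>x\<in>C. \<forall>y\<in>C. E (x, y)"
      using D(2,3) by blast
    ultimately show False using F E(2)[of "(\<lambda>y. {x. D (y, x)}) ` F"] by blast
  qed
  obtain s :: "nat \<Rightarrow> 'a" where s_all: "\<forall>n. s n \<in> S" "\<forall>m n. m < n \<longrightarrow> \<not> D (s m, s n)"
    by (rule separated_sequence[of S "\<lambda>y x. D (y, x)"]) (rule step)
  then have s: "\<And>n. s n \<in> S" "\<And>m n. m < n \<Longrightarrow> \<not> D (s m, s n)" by auto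
  have sep: "m = n" if "D (s m, s n)" for m n
    using that s(2)[of m n] s(2)[of n m] D(2) by (metis linorder_neqE_nat)
  have "\<exists>f. continuous_map X euclideanreal f \<and> f (s n) = Suc n \<and> (\<forall>y\<in>topspace X. f y \<noteq> 0 \<longrightarrow> B (s n, y))" for n
  proof -
    have sX: "s n \<in> topspace X" using s(1) SX by blast
    obtain W where W: "openin X W" "s n \<in> W" "\<forall>y\<in>W. B (s n, y)"
      using finest_uniformity_admissible[of X] B(1) sX unfolding admissible_uniformity_def by blast
    have "real (Suc n) \<noteq> 0" by simp
    from X[unfolded completely_regular_space_gen_alt'[OF this]] W(1,2)
    have "\<exists>f. continuous_map X euclideanreal f \<and> f (s n) = Suc n \<and> f ` (topspace X - W) \<subseteq> {0}"
      by simp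
    then obtain f where f: "continuous_map X euclideanreal f" "f (s n) = Suc n"
      "f ` (topspace X - W) \<subseteq> {0}"
      by (elim exE conjE)
    have "B (s n, y)" if "y \<in> topspace X" "f y \<noteq> 0" for y
      using that f(3) W(3) by blast
    with f(1,2) show ?thesis by (intro exI[of _ f]) auto
  qed
  then have "\<exists>h. \<forall>n. continuous_map X euclideanreal (h n) \<and> h n (s n) = Suc n \<and>
      (\<forall>y\<in>topspace X. h n y \<noteq> 0 \<longrightarrow> B (s n, y))"
    by (intro choice) blast
  then obtain h where "\<forall>n. continuous_map X euclideanreal (h n) \<and> h n (s n) = Suc n \<and>
      (\<forall>y\<in>topspace X. h n y \<noteq> 0 \<longrightarrow> B (s n, y))" ..
  then have h: "\<And>n. continuous_map X euclideanreal (h n)" "\<And>n. h n (s n) = Suc n"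
    "\<And>n y. y \<in> topspace X \<Longrightarrow> h n y \<noteq> 0 \<Longrightarrow> B (s n, y)"
    by auto
  define f where "f = (\<lambda>x. h (SOME k. h k x \<noteq> 0) x)"
  have "continuous_map X euclideanreal f"
    unfolding f_def
  proof (rule continuous_map_glue[OF h(1)])
    fix x assume x: "x \<in> topspace X"
    then obtain W where W: "openin X W" "x \<in> W" "\<forall>y\<in>W. B (x, y)"
      using finest_uniformity_admissible[of X] B(1) unfolding admissible_uniformity_def by blast
    have "k = m" if "y \<in> W" "z \<in> W" "h k y \<noteq> 0" "h m z \<noteq> 0" for y z k m
    proof -
      have "y \<in> topspace X" "z \<in> topspace X"
        using that(1,2) openin_subset[OF W(1)] by auto
      then have "B (s k, y)" "B (y, x)" "B (x, z)" "B (z, s m)"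
        using h(3) that W(3) B(2) by blast+
      then have "D (s k, s m)" using B(3) by blast
      then show "k = m" by (rule sep)
    qed
    then have "\<exists>m. \<forall>y\<in>W. \<forall>k. h k y \<noteq> 0 \<longrightarrow> k = m" by metis
    with W show "\<exists>W m. openin X W \<and> x \<in> W \<and> (\<forall>y\<in>W. \<forall>k. h k y \<noteq> 0 \<longrightarrow> k = m)" by blast
  qed
  then have "bounded (f ` S)"
    using S by (simp add: functionally_bounded_in_def)
  then obtain b where b: "\<And>x. x \<in> S \<Longrightarrow> \<bar>f x\<bar> \<le> b"
    unfolding bounded_iff by auto
  have "f (s n) = Suc n" for n
  proof -
    have "k = n" if "h k (s n) \<noteq> 0" for k
    proof -
      have "B (s k, s n)" "B (s n, s n)"
        using that s(1) SX h(3) uniformity_refl[OF U B(1)] by blast+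
      then have "D (s k, s n)" using B(3) by blast
      then show ?thesis by (rule sep)
    qed
    then have "(SOME k. h k (s n) \<noteq> 0) = n"
      using h(2)[of n] by (intro some_equality) auto
    then show ?thesis by (simp add: f_def h(2))
  qed
  moreover obtain n where "b < real n" using reals_Archimedean2 by blast
  ultimately show False using b[OF s(1)[of n]] by simp
qed

text \<open>The map \<open>j\<close> into the completion induces the universal uniformity on \<open>X\<close>, so total boundedness
of \<open>S\<close> in \<open>X\<close> and of its image in the completion are the same condition.\<close>

theorem functionally_bounded_iff_compact_closure:
  assumes X: "completely_regular_space X" and S: "S \<subseteq> topspace X"
    and D: "dieudonne_completion X M V j"
  shows "functionally_bounded_in X S \<longleftrightarrow>
    compactin (uniform_topology M V) (uniform_topology M V closure_of (j ` S))"
proof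
  let ?T = "uniform_topology M V"
  have V: "is_uniformity M V" "complete_uniformity M V" and j: "j ` topspace X \<subseteq> M"
    and U: "finest_uniformity X =
      inf (filtercomap (map_prod j j) V) (principal (topspace X \<times> topspace X))"
    using D universal_uniformity_eq[OF X]
    by (auto simp: dieudonne_completion_def uniform_completion_def)
  {
    assume "functionally_bounded_in X S"
    then have "totally_bounded_in (finest_uniformity X) S"
      by (rule totally_bounded_if_functionally_bounded[OF X])
    then have "totally_bounded_in V (j ` S)"
      unfolding U by (rule totally_bounded_in_image)
    then have "totally_bounded_in V (?T closure_of (j ` S))"
      by (rule totally_bounded_in_closure[OF V(1)])
    then show "compactin ?T (?T closure_of (j ` S))"
      by (rule complete_totally_bounded_imp_compactin[OF V closedin_closure_of])
  next
    assume "compactin ?T (?T closure_of (j ` S))"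
    then have "totally_bounded_in V (?T closure_of (j ` S))"
      by (rule compactin_imp_totally_bounded[OF V(1)])
    moreover have "j ` S \<subseteq> ?T closure_of (j ` S)"
      using S j topspace_uniform_topology[OF V(1)] by (intro closure_of_subset) auto
    ultimately have "totally_bounded_in V (j ` S)"
      by (rule totally_bounded_in_subset)
    then have "totally_bounded_in (finest_uniformity X) S"
      unfolding U by (intro totally_bounded_in_inf_principal totally_bounded_in_filtercomap S)
    with S show "functionally_bounded_in X S"
      by (rule functionally_bounded_if_totally_bounded)
  }
qed

section \<open>Uniform boundedness for finitely supported coefficients\<close>

text \<open>A clamped sum of bumps taking the value \<open>sgn (a x)\<close> at each \<open>x \<in> T\<close>: the functional with
coefficients \<open>a\<close> attains the norm \<open>\<Sum>x\<in>T. \<bar>a x\<bar>\<close> on the unit ball of the bounded continuous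
functions.\<close>

lemma exists_norming_function:
  fixes a :: "'a \<Rightarrow> real"
  assumes X: "completely_regular_space X" "Hausdorff_space X"
    and T: "finite T" "T \<subseteq> topspace X"
  shows "\<exists>h. continuous_map X euclideanreal h \<and> (\<forall>x. \<bar>h x\<bar> \<le> 1) \<and> (\<forall>x\<in>T. a x * h x = \<bar>a x\<bar>)"
proof -
  have "\<exists>f. continuous_map X euclideanreal f \<and> f x = 1 \<and> f ` (T - {x}) \<subseteq> {0}" if x: "x \<in> T" for x
  proof -
    have "closedin X (T - {x})"
      using T by (intro closedin_Hausdorff_finite[OF X(2)]) auto
    moreover have "x \<in> topspace X - (T - {x})" using x T(2) by auto
    ultimately show ?thesis
      using X(1)[unfolded completely_regular_space_gen_alt[OF one_neq_zero]] by blast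
  qed
  then have "\<exists>f. \<forall>x\<in>T. continuous_map X euclideanreal (f x) \<and> f x x = 1 \<and> f x ` (T - {x}) \<subseteq> {0}"
    by (intro bchoice) blast
  then obtain f where f: "\<forall>x\<in>T. continuous_map X euclideanreal (f x) \<and> f x x = 1 \<and> f x ` (T - {x}) \<subseteq> {0}" ..
  define g where "g = (\<lambda>y. \<Sum>x\<in>T. sgn (a x) * f x y)"
  define h where "h = (\<lambda>y. max (- 1) (min 1 (g y)))"
  have "continuous_map X euclideanreal g"
    unfolding g_def using f T(1) by (intro continuous_map_sum continuous_map_real_mult_left) auto
  then have "continuous_map X euclideanreal h"
    unfolding h_def by (intro continuous_map_real_max continuous_map_real_min) auto
  moreover have "\<bar>h x\<bar> \<le> 1" for x by (auto simp: h_def)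
  moreover have "a x * h x = \<bar>a x\<bar>" if x: "x \<in> T" for x
  proof -
    have "g x = (\<Sum>y\<in>T. if y = x then sgn (a x) else 0)"
      unfolding g_def using f x by (intro sum.cong) (auto simp: image_subset_iff)
    then have "g x = sgn (a x)" using T(1) x by simp
    then have "h x = sgn (a x)" by (auto simp: h_def sgn_real_def)
    then show ?thesis by (simp add: abs_sgn[symmetric])
  qed
  ultimately show ?thesis by blast
qed

lemma geometric_series_tail:
  fixes c :: "nat \<Rightarrow> real" and u :: "nat \<Rightarrow> real"
  assumes c: "\<And>k. \<bar>c k\<bar> = (1/3) ^ k" and u: "\<And>k. \<bar>u k\<bar> \<le> 1"
  shows "\<bar>(\<Sum>k. c k * u k) - (\<Sum>k<n. c k * u k)\<bar> \<le> 3/2 * (1/3) ^ n"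
proof -
  have le: "norm (c k * u k) \<le> (1/3) ^ k" for k
    using c[of k] u[of k] by (simp add: abs_mult mult_left_le)
  have geo: "summable (\<lambda>k. (1/3::real) ^ k)" by (simp add: summable_geometric)
  have sm: "summable (\<lambda>k. c k * u k)"
    by (rule summable_comparison_test'[OF geo]) (rule le)
  have "(\<Sum>k. c k * u k) - (\<Sum>k<n. c k * u k) = (\<Sum>k. c (k + n) * u (k + n))"
    using suminf_minus_initial_segment[OF sm, of n] by simp
  also have "norm \<dots> \<le> (\<Sum>k. (1/3) ^ n * (1/3) ^ k)"
  proof (rule norm_suminf_le)
    show "norm (c (k + n) * u (k + n)) \<le> (1/3) ^ n * (1/3) ^ k" for k
      using le[of "k + n"] by (simp add: power_add mult.commute)
    show "summable (\<lambda>k. (1/3::real) ^ n * (1/3) ^ k)"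
      by (rule summable_mult[OF geo])
  qed
  also have "\<dots> = (1/3) ^ n * (\<Sum>k. (1/3) ^ k)"
    by (rule suminf_mult[OF geo])
  also have "(\<Sum>k. (1/3::real) ^ k) = 3/2"
    by (simp add: suminf_geometric)
  finally show ?thesis by (simp add: mult.commute)
qed

lemma continuous_map_series:
  fixes h :: "nat \<Rightarrow> 'a \<Rightarrow> real"
  assumes c: "\<And>k. \<bar>c k\<bar> = (1/3) ^ k" and h: "\<And>k. continuous_map X euclideanreal (h k)"
    and bound: "\<And>k x. \<bar>h k x\<bar> \<le> 1"
  shows "continuous_map X euclideanreal (\<lambda>x. \<Sum>k. c k * h k x)"
proof -
  have "continuous_map X Met_TC.mtopology (\<lambda>x. \<Sum>k. c k * h k x)"
  proof (rule Met_TC.continuous_map_uniform_limit)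
    show "\<forall>\<^sub>F n in sequentially. continuous_map X Met_TC.mtopology (\<lambda>x. \<Sum>k<n. c k * h k x)"
      by (intro always_eventually allI) (auto intro!: continuous_map_sum continuous_map_real_mult_left h)
    fix e :: real assume e: "0 < e"
    have "(\<lambda>n. 3/2 * (1/3::real) ^ n) \<longlonglongrightarrow> 3/2 * 0"
      by (intro tendsto_mult tendsto_const LIMSEQ_power_zero) simp
    then have "\<forall>\<^sub>F n in sequentially. 3/2 * (1/3::real) ^ n < e"
      using e by (intro order_tendstoD(2)) auto
    then show "\<forall>\<^sub>F n in sequentially. \<forall>x\<in>topspace X. (\<Sum>k. c k * h k x) \<in> UNIV \<and>
        dist (\<Sum>k<n. c k * h k x) (\<Sum>k. c k * h k x) < e"
    proof eventually_elim
      case (elim n)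
      have "dist (\<Sum>k<n. c k * h k x) (\<Sum>k. c k * h k x) < e" for x
        using geometric_series_tail[of c "\<lambda>k. h k x" n] c bound elim
        by (simp add: dist_real_def abs_minus_commute)
      then show ?case by simp
    qed
  qed simp
  then show ?thesis by simp
qed

text \<open>The uniform boundedness principle on the Banach space of bounded continuous functions, proved
by a gliding hump. If the norms \<open>N n\<close> of a sequence of functionals \<open>P n\<close> grow faster than
\<open>2 * 3 ^ n * n\<close>, a single function \<open>f = (\<Sum>n. c n * h n)\<close> with \<open>\<bar>c n\<bar> = (1/3) ^ n\<close> is built
from norming functions \<open>h n\<close>. The sign of \<open>c n\<close> agrees with the value of \<open>P n\<close> on the earlier
terms, so the partial sum through index \<open>n\<close> has \<open>P n\<close>-value at least \<open>(1/3) ^ n * N n\<close>; the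
remaining terms sum to at most half of \<open>(1/3) ^ n\<close> and can spoil at most half of that value.\<close>

lemma uniform_bound_of_coefficient_sums:
  fixes a :: "'i \<Rightarrow> 'a \<Rightarrow> real"
  assumes X: "completely_regular_space X" "Hausdorff_space X"
    and T: "\<And>i. i \<in> I \<Longrightarrow> finite (T i) \<and> T i \<subseteq> topspace X"
    and pointwise: "\<And>f. continuous_map X euclideanreal f \<Longrightarrow>
      \<exists>b. \<forall>i\<in>I. \<bar>\<Sum>x\<in>T i. a i x * f x\<bar> \<le> b"
  shows "\<exists>b. \<forall>i\<in>I. (\<Sum>x\<in>T i. \<bar>a i x\<bar>) \<le> b"
proof (rule ccontr)
  assume "\<not> ?thesis"
  then have "\<forall>n::nat. \<exists>i. i \<in> I \<and> 2 * 3 ^ n * real n < (\<Sum>x\<in>T i. \<bar>a i x\<bar>)"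
    by (meson not_le)
  then obtain w where w: "\<forall>n::nat. w n \<in> I \<and> 2 * 3 ^ n * real n < (\<Sum>x\<in>T (w n). \<bar>a (w n) x\<bar>)"
    by (auto dest: choice)
  define N where "N = (\<lambda>n. \<Sum>x\<in>T (w n). \<bar>a (w n) x\<bar>)"
  define P where "P = (\<lambda>n f. \<Sum>x\<in>T (w n). a (w n) x * f x)"
  have wT: "finite (T (w n))" "T (w n) \<subseteq> topspace X" for n
    using T w by auto
  have "\<exists>h. \<forall>n. continuous_map X euclideanreal (h n) \<and> (\<forall>x. \<bar>h n x\<bar> \<le> 1) \<and>
      (\<forall>x\<in>T (w n). a (w n) x * h n x = \<bar>a (w n) x\<bar>)"
    by (intro choice allI exists_norming_function X wT)
  then obtain h where h': "\<forall>n. continuous_map X euclideanreal (h n) \<and> (\<forall>x. \<bar>h n x\<bar> \<le> 1) \<and>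
      (\<forall>x\<in>T (w n). a (w n) x * h n x = \<bar>a (w n) x\<bar>)" ..
  then have h: "continuous_map X euclideanreal (h n)" "\<bar>h n x\<bar> \<le> 1" for n x by auto
  have Ph: "P n (h n) = N n" for n
    unfolding P_def N_def using h' by (intro sum.cong) auto
  have P_add: "P n (\<lambda>x. f x + c * g x) = P n f + c * P n g" for n f g c
    unfolding P_def by (simp add: algebra_simps sum.distrib sum_distrib_left)
  have "\<exists>c::nat \<Rightarrow> real. \<forall>n. \<bar>c n\<bar> = (1/3) ^ n \<and>
      (1/3) ^ n * N n \<le> \<bar>P n (\<lambda>x. (\<Sum>k<n. c k * h k x) + c n * h n x)\<bar>"
  proof (rule dependent_wellorder_choice)
    fix r :: real and c c' :: "nat \<Rightarrow> real" and n :: nat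
    assume "\<And>k. k < n \<Longrightarrow> c k = c' k"
    then have "(\<Sum>k<n. c k * h k x) = (\<Sum>k<n. c' k * h k x)" for x by simp
    then show "(\<bar>r\<bar> = (1/3) ^ n \<and> (1/3) ^ n * N n \<le> \<bar>P n (\<lambda>x. (\<Sum>k<n. c k * h k x) + r * h n x)\<bar>) =
        (\<bar>r\<bar> = (1/3) ^ n \<and> (1/3) ^ n * N n \<le> \<bar>P n (\<lambda>x. (\<Sum>k<n. c' k * h k x) + r * h n x)\<bar>)"
      by simp
  next
    fix n :: nat and c :: "nat \<Rightarrow> real"
    let ?p = "P n (\<lambda>x. \<Sum>k<n. c k * h k x)"
    have "N n \<ge> 0" by (simp add: N_def sum_nonneg)
    then have "(1/3) ^ n * N n \<ge> 0" by simp
    then have "(1/3) ^ n * N n \<le> \<bar>?p + (if ?p \<ge> 0 then (1/3) ^ n else - ((1/3) ^ n)) * N n\<bar>"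
      by auto
    then show "\<exists>r. \<bar>r\<bar> = (1/3) ^ n \<and>
        (1/3) ^ n * N n \<le> \<bar>P n (\<lambda>x. (\<Sum>k<n. c k * h k x) + r * h n x)\<bar>"
      unfolding P_add Ph by (intro exI[of _ "if ?p \<ge> 0 then (1/3) ^ n else - ((1/3) ^ n)"]) simp
  qed
  then obtain c where c': "\<forall>n. \<bar>c n\<bar> = (1/3) ^ n \<and>
      (1/3) ^ n * N n \<le> \<bar>P n (\<lambda>x. (\<Sum>k<n. c k * h k x) + c n * h n x)\<bar>" ..
  then have c: "\<bar>c k\<bar> = (1/3) ^ k" for k by simp
  define f where "f = (\<lambda>x. \<Sum>k. c k * h k x)"
  have "continuous_map X euclideanreal f"
    unfolding f_def by (rule continuous_map_series[OF c h])
  then obtain b where b: "\<forall>i\<in>I. \<bar>\<Sum>x\<in>T i. a i x * f x\<bar> \<le> b"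
    using pointwise by blast
  have large: "real n \<le> \<bar>P n f\<bar>" for n
  proof -
    let ?s = "\<lambda>x. \<Sum>k<Suc n. c k * h k x"
    have "\<bar>P n f - P n ?s\<bar> = \<bar>\<Sum>x\<in>T (w n). a (w n) x * (f x - ?s x)\<bar>"
      by (simp add: P_def sum_subtractf[symmetric] right_diff_distrib)
    also have "\<dots> \<le> (\<Sum>x\<in>T (w n). \<bar>a (w n) x * (f x - ?s x)\<bar>)"
      by (rule sum_abs)
    also have "\<dots> \<le> (\<Sum>x\<in>T (w n). \<bar>a (w n) x\<bar> * (3/2 * (1/3) ^ Suc n))"
    proof (rule sum_mono)
      fix x
      have "\<bar>f x - ?s x\<bar> \<le> 3/2 * (1/3) ^ Suc n"
        unfolding f_def by (rule geometric_series_tail[OF c h(2)])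
      then show "\<bar>a (w n) x * (f x - ?s x)\<bar> \<le> \<bar>a (w n) x\<bar> * (3/2 * (1/3) ^ Suc n)"
        unfolding abs_mult by (rule mult_left_mono) simp
    qed
    also have "\<dots> = N n * (3/2 * (1/3) ^ Suc n)"
      by (simp only: N_def sum_distrib_right)
    also have "\<dots> = 1/2 * ((1/3) ^ n * N n)"
      by simp
    finally have "\<bar>P n f - P n ?s\<bar> \<le> 1/2 * ((1/3) ^ n * N n)" .
    moreover have "(1/3) ^ n * N n \<le> \<bar>P n ?s\<bar>"
      using c' by simp
    ultimately have "1/2 * ((1/3) ^ n * N n) \<le> \<bar>P n f\<bar>" by linarith
    moreover have "real n \<le> 1/2 * ((1/3) ^ n * N n)"
    proof -
      have "2 * 3 ^ n * real n \<le> N n" using w by (simp add: N_def less_imp_le)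
      then have "(1/3) ^ n * (2 * 3 ^ n * real n) \<le> (1/3) ^ n * N n"
        by (intro mult_left_mono) auto
      then show ?thesis by (simp add: power_one_over field_simps)
    qed
    ultimately show ?thesis by linarith
  qed
  obtain n where "b < real n" using reals_Archimedean2 by blast
  moreover have "\<bar>P n f\<bar> \<le> b" using b w by (simp add: P_def)
  ultimately show False using large[of n] by linarith
qed

text \<open>The function \<open>\<phi> t = (\<Sum>k. c k * max 0 (t - k))\<close>, in which only the terms with \<open>k < t\<close>
contribute; on each half-line \<open>t \<le> n\<close> it is a finite sum of continuous functions.\<close>

lemma continuous_function_dominating_sequence:
  fixes c :: "nat \<Rightarrow> real"
  assumes c: "\<And>k. c k \<ge> 0"
  obtains \<phi> :: "real \<Rightarrow> real" where "continuous_on UNIV \<phi>" "\<forall>t. \<phi> t \<ge> 0"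
    "\<forall>k t. real k + 1 \<le> t \<longrightarrow> c k \<le> \<phi> t"
proof -
  define S where "S = (\<lambda>n t. \<Sum>k<n. c k * max 0 (t - real k))"
  define \<phi> where "\<phi> = (\<lambda>t. S (nat \<lceil>t\<rceil>) t)"
  have phi_eq: "\<phi> t = S n t" if "t \<le> real n" for n t
    unfolding \<phi>_def S_def
  proof (rule sum.mono_neutral_left)
    show "{..<nat \<lceil>t\<rceil>} \<subseteq> {..<n}" using that by (auto simp: less_le_trans nat_le_iff ceiling_le_iff)
    show "\<forall>k\<in>{..<n} - {..<nat \<lceil>t\<rceil>}. c k * max 0 (t - real k) = 0"
    proof
      fix k assume "k \<in> {..<n} - {..<nat \<lceil>t\<rceil>}"
      then have "t \<le> real k" by auto
      then show "c k * max 0 (t - real k) = 0" by simp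
    qed
  qed simp
  have "isCont \<phi> t" for t
  proof -
    obtain n where "t < real n" using reals_Archimedean2 by blast
    then have "eventually (\<lambda>u. u < real n) (nhds t)"
      by (rule order_tendstoD(2)[OF filterlim_ident])
    then have "eventually (\<lambda>u. \<phi> u = S n u) (nhds t)"
      by eventually_elim (simp add: phi_eq)
    moreover have "isCont (S n) t"
      unfolding S_def by (intro continuous_intros)
    ultimately show ?thesis by (simp add: isCont_cong)
  qed
  then have "continuous_on UNIV \<phi>" by (simp add: continuous_on_eq_continuous_at)
  moreover have "\<phi> t \<ge> 0" for t
    unfolding \<phi>_def S_def using c by (intro sum_nonneg) simp
  moreover have "c k \<le> \<phi> t" if "real k + 1 \<le> t" for k t
  proof -
    have "c k \<le> c k * max 0 (t - real k)"
      using that c[of k] by (simp add: mult_le_cancel_left1)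
    also have "\<dots> \<le> \<phi> t"
      unfolding \<phi>_def S_def
    proof (rule member_le_sum)
      show "k \<in> {..<nat \<lceil>t\<rceil>}" using that by simp linarith
    qed (use c in auto)
    finally show ?thesis .
  qed
  ultimately show thesis by (intro that[of \<phi>]) auto
qed

text \<open>Pointwise boundedness survives multiplication of all coefficients by a continuous function
\<open>\<psi>\<close>, so the weighted coefficient sums are bounded too. If \<open>\<bar>g\<bar>\<close> is at least \<open>k + 1\<close> at the
point \<open>x\<close> in the support of the functional with index \<open>i\<close>, for suitable \<open>i\<close> and \<open>x\<close> depending
on \<open>k\<close>, then a weight \<open>\<psi> = \<phi> \<circ> \<bar>g\<bar>\<close> with \<open>\<phi>\<close> at least \<open>k / \<bar>a i x\<bar>\<close> from \<open>k + 1\<close> on makes the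
\<open>k\<close>-th weighted sum at least \<open>k\<close>.\<close>

lemma supports_functionally_bounded:
  fixes a :: "'i \<Rightarrow> 'a \<Rightarrow> real"
  assumes X: "completely_regular_space X" "Hausdorff_space X"
    and T: "\<And>i. i \<in> I \<Longrightarrow> finite (T i) \<and> T i \<subseteq> topspace X"
    and nonzero: "\<And>i x. i \<in> I \<Longrightarrow> x \<in> T i \<Longrightarrow> a i x \<noteq> 0"
    and pointwise: "\<And>f. continuous_map X euclideanreal f \<Longrightarrow>
      \<exists>b. \<forall>i\<in>I. \<bar>\<Sum>x\<in>T i. a i x * f x\<bar> \<le> b"
  shows "functionally_bounded_in X (\<Union>i\<in>I. T i)"
  unfolding functionally_bounded_in_def
proof (intro conjI allI impI)
  show "(\<Union>i\<in>I. T i) \<subseteq> topspace X" using T by blast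
  fix g assume g: "continuous_map X euclideanreal g"
  show "bounded (g ` (\<Union>i\<in>I. T i))"
  proof (rule ccontr)
    assume "\<not> ?thesis"
    then have "\<not> (\<exists>b. \<forall>x\<in>(\<Union>i\<in>I. T i). \<bar>g x\<bar> \<le> b)"
      by (simp add: bounded_iff)
    then have "\<forall>k::nat. \<exists>p. fst p \<in> I \<and> snd p \<in> T (fst p) \<and> real k + 1 \<le> \<bar>g (snd p)\<bar>"
      by (metis UN_E fst_conv snd_conv linear)
    from choice[OF this] obtain p where p: "\<forall>k::nat. fst (p k) \<in> I \<and> snd (p k) \<in> T (fst (p k)) \<and>
        real k + 1 \<le> \<bar>g (snd (p k))\<bar>" ..
    define c where "c = (\<lambda>k. real k / \<bar>a (fst (p k)) (snd (p k))\<bar>)"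
    obtain \<phi> where \<phi>: "continuous_on UNIV \<phi>" "\<forall>t. \<phi> t \<ge> 0" "\<forall>k t. real k + 1 \<le> t \<longrightarrow> c k \<le> \<phi> t"
      by (rule continuous_function_dominating_sequence[of c]) (simp add: c_def)
    define \<psi> where "\<psi> = (\<lambda>x. \<phi> \<bar>g x\<bar>)"
    have "continuous_map X euclideanreal (\<lambda>x. \<bar>g x\<bar>)"
      by (rule continuous_map_real_abs[OF g])
    then have \<psi>: "continuous_map X euclideanreal \<psi>"
      using continuous_map_compose[of X euclideanreal "\<lambda>x. \<bar>g x\<bar>" euclideanreal \<phi>] \<phi>(1)
      by (simp add: \<psi>_def o_def)
    have "\<exists>b. \<forall>i\<in>I. (\<Sum>x\<in>T i. \<bar>a i x * \<psi> x\<bar>) \<le> b"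
    proof (rule uniform_bound_of_coefficient_sums[OF X T])
      fix f assume "continuous_map X euclideanreal f"
      then have "continuous_map X euclideanreal (\<lambda>x. \<psi> x * f x)"
        by (intro continuous_map_real_mult \<psi>)
      from pointwise[OF this] show "\<exists>b. \<forall>i\<in>I. \<bar>\<Sum>x\<in>T i. a i x * \<psi> x * f x\<bar> \<le> b"
        by (simp add: mult.assoc)
    qed
    then obtain b where b: "\<And>i. i \<in> I \<Longrightarrow> (\<Sum>x\<in>T i. \<bar>a i x * \<psi> x\<bar>) \<le> b" by blast
    obtain k where k: "b < real k" using reals_Archimedean2 by blast
    let ?i = "fst (p k)" and ?x = "snd (p k)"
    have pk: "?i \<in> I" "?x \<in> T ?i" "real k + 1 \<le> \<bar>g ?x\<bar>" using p by auto
    have "a ?i ?x \<noteq> 0" using nonzero pk by blast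
    then have "real k = \<bar>a ?i ?x\<bar> * c k" by (simp add: c_def)
    also have "\<dots> \<le> \<bar>a ?i ?x\<bar> * \<psi> ?x"
      using \<phi>(3) pk(3) by (intro mult_left_mono) (auto simp: \<psi>_def)
    also have "\<dots> = \<bar>a ?i ?x * \<psi> ?x\<bar>" using \<phi>(2) by (simp add: abs_mult \<psi>_def)
    also have "\<dots> \<le> (\<Sum>x\<in>T ?i. \<bar>a ?i x * \<psi> x\<bar>)"
      using T[OF pk(1)] pk(2) by (intro member_le_sum) auto
    also have "\<dots> \<le> b" by (rule b[OF pk(1)])
    finally show False using k by simp
  qed
qed

section \<open>Continuous seminorms on a locally convex space\<close>

lemma lcs_operations_continuous:
  assumes L: "lcs L" "topspace L = UNIV"
  shows "continuous_map L L (\<lambda>v. c *\<^sub>R v)" "continuous_map euclideanreal L (\<lambda>c. c *\<^sub>R v)"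
    "continuous_map L L (\<lambda>u. u + w)"
proof -
  have add: "continuous_map (prod_topology L L) L (\<lambda>(x, y). x + y)"
    and scale: "continuous_map (prod_topology euclideanreal L) L (\<lambda>(c, x). c *\<^sub>R x)"
    using L by (auto simp: lcs_def)
  have "continuous_map L (prod_topology euclideanreal L) (\<lambda>v. (c, v))"
    by (intro continuous_map_pairedI) (auto simp: continuous_map_const)
  from continuous_map_compose[OF this scale] show "continuous_map L L (\<lambda>v. c *\<^sub>R v)"
    by (simp add: o_def)
  have "continuous_map euclideanreal (prod_topology euclideanreal L) (\<lambda>c. (c, v))"
    using L(2) by (intro continuous_map_pairedI) (auto simp: continuous_map_const)
  from continuous_map_compose[OF this scale] show "continuous_map euclideanreal L (\<lambda>c. c *\<^sub>R v)"
    by (simp add: o_def)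
  have "continuous_map L (prod_topology L L) (\<lambda>u. (u, w))"
    using L(2) by (intro continuous_map_pairedI) (auto simp: continuous_map_const)
  from continuous_map_compose[OF this add] show "continuous_map L L (\<lambda>u. u + w)"
    by (simp add: o_def)
qed

lemma lcs_symmetric_convex_nbhd:
  assumes L: "lcs L" "topspace L = UNIV" and U: "openin L U" "0 \<in> U"
  obtains B where "openin L B" "0 \<in> B" "convex B" "B \<subseteq> U" "\<forall>v\<in>B. - v \<in> B"
proof -
  obtain W where W: "openin L W" "0 \<in> W" "convex W" "W \<subseteq> U"
    by (rule lcs_convex_nbhd[OF L(1) U])
  have eq: "{v \<in> topspace L. (- 1) *\<^sub>R v \<in> W} = uminus ` W"
    using L(2) by (auto simp: image_iff) (metis add.inverse_inverse)
  have "openin L (uminus ` W)"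
    unfolding eq[symmetric]
    by (rule openin_continuous_map_preimage[OF lcs_operations_continuous(1)[OF L] W(1)])
  moreover have "convex (uminus ` W)"
    using W(3) by (rule convex_negations)
  ultimately show thesis
    using W by (intro that[of "W \<inter> uminus ` W"]) (auto intro: convex_Int)
qed

definition minkowski :: "'v::real_vector set \<Rightarrow> 'v \<Rightarrow> real" where
  "minkowski B v = Inf {t. 0 < t \<and> (1 / t) *\<^sub>R v \<in> B}"

lemma convex_shrink:
  assumes "convex B" "0 \<in> B" "0 < s" "s \<le> t" "(1 / s) *\<^sub>R v \<in> B"
  shows "(1 / t) *\<^sub>R v \<in> B"
proof -
  have "(s / t) *\<^sub>R ((1 / s) *\<^sub>R v) + (1 - s / t) *\<^sub>R 0 \<in> B"
    using assms by (intro convexD) auto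
  then show ?thesis using assms(3) by simp
qed

context
  fixes L :: "'v::real_vector topology" and B :: "'v set"
  assumes L: "lcs L" "topspace L = UNIV"
    and B: "openin L B" "0 \<in> B" "convex B" "\<forall>v\<in>B. - v \<in> B"
begin

lemma minkowski_absorbs: "\<exists>t>0. (1 / t) *\<^sub>R v \<in> B"
proof -
  have "openin euclideanreal {c \<in> topspace euclideanreal. c *\<^sub>R v \<in> B}"
    by (rule openin_continuous_map_preimage[OF lcs_operations_continuous(2)[OF L] B(1)])
  then have "open {c. c *\<^sub>R v \<in> B}" by simp
  moreover have "0 \<in> {c. c *\<^sub>R v \<in> B}" using B(2) by simp
  ultimately obtain e where e: "e > 0" "ball 0 e \<subseteq> {c. c *\<^sub>R v \<in> B}"
    unfolding open_contains_ball by blast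
  then have "(e / 2) *\<^sub>R v \<in> B" by (auto simp: subset_iff)
  with e(1) show ?thesis by (intro exI[of _ "2 / e"]) simp
qed

lemma minkowski_le: "0 < t \<Longrightarrow> (1 / t) *\<^sub>R v \<in> B \<Longrightarrow> minkowski B v \<le> t"
  unfolding minkowski_def by (rule cInf_lower) (auto intro!: bdd_belowI[of _ 0])

lemma minkowski_nonneg: "0 \<le> minkowski B v"
  unfolding minkowski_def using minkowski_absorbs[of v] by (intro cInf_greatest) auto

lemma minkowski_less_imp:
  assumes "minkowski B v < t"
  shows "(1 / t) *\<^sub>R v \<in> B"
proof -
  have "{t. 0 < t \<and> (1 / t) *\<^sub>R v \<in> B} \<noteq> {}" using minkowski_absorbs[of v] by auto
  from cInf_lessD[OF this assms[unfolded minkowski_def]]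
  obtain s where "0 < s" "(1 / s) *\<^sub>R v \<in> B" "s < t" by auto
  then show ?thesis by (intro convex_shrink[OF B(3,2), of s t v]) auto
qed

lemma minkowski_triangle: "minkowski B (u + v) \<le> minkowski B u + minkowski B v"
proof (rule field_le_epsilon)
  fix e :: real assume e: "0 < e"
  define s t where "s = minkowski B u + e / 2" and "t = minkowski B v + e / 2"
  have st: "0 < s" "0 < t"
    using e minkowski_nonneg[of u] minkowski_nonneg[of v] by (auto simp: s_def t_def)
  have "(1 / s) *\<^sub>R u \<in> B" "(1 / t) *\<^sub>R v \<in> B"
    using e by (auto simp: s_def t_def intro!: minkowski_less_imp)
  then have "(s / (s + t)) *\<^sub>R ((1 / s) *\<^sub>R u) + (t / (s + t)) *\<^sub>R ((1 / t) *\<^sub>R v) \<in> B"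
    using st by (intro convexD[OF B(3)]) (auto simp: add_divide_distrib[symmetric])
  then have "(1 / (s + t)) *\<^sub>R (u + v) \<in> B"
    using st by (simp add: scaleR_add_right)
  then have "minkowski B (u + v) \<le> s + t"
    using st by (intro minkowski_le) auto
  then show "minkowski B (u + v) \<le> minkowski B u + minkowski B v + e"
    by (simp add: s_def t_def)
qed

lemma minkowski_minus: "minkowski B (- v) = minkowski B v"
proof -
  have "(1 / t) *\<^sub>R (- v) \<in> B \<longleftrightarrow> (1 / t) *\<^sub>R v \<in> B" for t
    using B(4) by (metis add.inverse_inverse scaleR_minus_right)
  then show ?thesis by (simp add: minkowski_def)
qed

lemma minkowski_scaleR_le: "minkowski B (c *\<^sub>R v) \<le> \<bar>c\<bar> * minkowski B v"
proof -
  have pos: "minkowski B (c *\<^sub>R v) \<le> c * minkowski B v" if "c > 0" for c v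
  proof -
    have "minkowski B (c *\<^sub>R v) / c \<le> minkowski B v"
    proof (rule field_le_epsilon)
      fix e :: real assume e: "0 < e"
      define t where "t = minkowski B v + e"
      have t: "0 < t" "(1 / t) *\<^sub>R v \<in> B"
        using e minkowski_nonneg[of v] by (auto simp: t_def intro!: minkowski_less_imp)
      then have "minkowski B (c *\<^sub>R v) \<le> c * t"
        using that by (intro minkowski_le) auto
      then show "minkowski B (c *\<^sub>R v) / c \<le> minkowski B v + e"
        using that by (simp add: t_def field_simps)
    qed
    then show ?thesis using that by (simp add: field_simps)
  qed
  have "minkowski B 0 \<le> 0"
    by (rule field_le_epsilon) (use B(2) in \<open>auto intro!: minkowski_le\<close>)
  then show ?thesis
    using pos[of c v] pos[of "- c" v] minkowski_minus[of "c *\<^sub>R v"]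
    by (cases c "0::real" rule: linorder_cases) auto
qed

text \<open>In place of the explicit seminorm laws, this is the one consequence of subadditivity and
homogeneity that bounds a combination by its coefficients.\<close>

lemma minkowski_sum_le:
  assumes "finite F"
  shows "minkowski B (\<Sum>x\<in>F. c x *\<^sub>R f x) \<le> (\<Sum>x\<in>F. \<bar>c x\<bar> * minkowski B (f x))"
  using assms
proof induction
  case empty
  show ?case using minkowski_scaleR_le[of 0 0] by simp
next
  case (insert x F)
  have "minkowski B (\<Sum>x\<in>insert x F. c x *\<^sub>R f x) \<le> minkowski B (c x *\<^sub>R f x) + minkowski B (\<Sum>x\<in>F. c x *\<^sub>R f x)"
    using insert.hyps by (simp add: minkowski_triangle)
  also have "\<dots> \<le> \<bar>c x\<bar> * minkowski B (f x) + (\<Sum>x\<in>F. \<bar>c x\<bar> * minkowski B (f x))"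
    by (intro add_mono minkowski_scaleR_le insert.IH)
  finally show ?case using insert.hyps by simp
qed

lemma minkowski_continuous: "continuous_map L euclideanreal (minkowski B)"
  unfolding continuous_map_eq_topcontinuous_at topcontinuous_at_def
proof (intro ballI conjI allI impI)
  fix v T assume T: "openin euclideanreal T \<and> minkowski B v \<in> T"
  then obtain e where e: "e > 0" "ball (minkowski B v) e \<subseteq> T"
    by (auto simp: open_contains_ball)
  \<comment> \<open>on \<open>W\<close> the seminorm of \<open>u - v\<close> is at most \<open>e / 2\<close>, half of what is allowed, as membership in \<open>B\<close>
    gives no strict inequality\<close>
  define W where "W = {u. (2 / e) *\<^sub>R (u + - v) \<in> B}"
  have "continuous_map L L (\<lambda>u. (2 / e) *\<^sub>R (u + - v))"
    using continuous_map_compose[OF lcs_operations_continuous(3)[OF L, of "- v"]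
        lcs_operations_continuous(1)[OF L, of "2 / e"]]
    by (simp add: o_def)
  from openin_continuous_map_preimage[OF this B(1)] have "openin L W"
    using L(2) by (simp add: W_def)
  moreover have "v \<in> W" using B(2) by (simp add: W_def)
  moreover have "minkowski B u \<in> T" if "u \<in> W" for u
  proof -
    have "minkowski B (u - v) \<le> e / 2"
      using that e(1) by (intro minkowski_le) (auto simp: W_def)
    moreover have "minkowski B u \<le> minkowski B v + minkowski B (u - v)"
      using minkowski_triangle[of v "u - v"] by simp
    moreover have "minkowski B v \<le> minkowski B u + minkowski B (u - v)"
      using minkowski_triangle[of u "v - u"] minkowski_minus[of "u - v"] by simp
    ultimately have "\<bar>minkowski B v - minkowski B u\<bar> < e" using e(1) by linarith
    then show ?thesis using e(2) by (auto simp: dist_real_def subset_iff)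
  qed
  ultimately show "\<exists>U. openin L U \<and> v \<in> U \<and> (\<forall>u\<in>U. minkowski B u \<in> T)" by blast
qed auto

end

section \<open>Bounded subsets of the free locally convex space\<close>

lemma finite_supp:
  assumes "inj_on i (topspace X)"
  shows "finite (supp X i v)"
proof -
  have "i ` supp X i v \<subseteq> {b. representation (i ` topspace X) v b \<noteq> 0}"
    by (auto simp: supp_def)
  then have "finite (i ` supp X i v)"
    by (rule finite_subset) (rule finite_representation)
  moreover have "inj_on i (supp X i v)"
    using assms by (rule inj_on_subset) (auto simp: supp_def)
  ultimately show ?thesis by (rule finite_imageD)
qed

lemma free_lcs_expansion:
  fixes L :: "'v::real_vector topology"
  assumes "completely_regular_space X" "Hausdorff_space X" "free_lcs X L i"
  shows "(\<Sum>x\<in>supp X i v. representation (i ` topspace X) v (i x) *\<^sub>R i x) = v"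
proof -
  let ?B = "i ` topspace X"
  have inj: "inj_on i (supp X i v)"
    using free_lcs_inj_on[OF assms] by (rule inj_on_subset) (auto simp: supp_def)
  have "{b. representation ?B v b \<noteq> 0} = i ` supp X i v"
    using representation_ne_zero[of ?B v] by (auto simp: supp_def)
  then have "(\<Sum>x\<in>supp X i v. representation ?B v (i x) *\<^sub>R i x) =
      (\<Sum>b | representation ?B v b \<noteq> 0. representation ?B v b *\<^sub>R b)"
    using inj by (simp add: sum.reindex)
  also have "\<dots> = v"
    using free_lcs_independent[OF assms] free_lcs_span[OF assms(3)]
    by (intro sum_nonzero_representation_eq) auto
  finally show ?thesis .
qed

text \<open>The sum is the value at \<open>v\<close> of the continuous linear extension of \<open>f\<close> to \<open>L\<close>, and a continuous
linear functional is bounded on bounded sets.\<close>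

lemma bounded_imp_pointwise_bounded:
  fixes L :: "'v::real_vector topology"
  assumes X: "completely_regular_space X" "Hausdorff_space X" and free: "free_lcs X L i"
    and A: "lcs_bounded L A" and f: "continuous_map X euclideanreal f"
  shows "\<exists>b. \<forall>v\<in>A. \<bar>\<Sum>x\<in>supp X i v. representation (i ` topspace X) v (i x) * f x\<bar> \<le> b"
proof -
  have L: "topspace L = UNIV" and "lcs_extension_property TYPE(real) X L i"
    using free by (auto simp: free_lcs_def)
  from lcs_extension_ex[OF this(2) lcs_real f]
  obtain g where g: "linear g" "continuous_map L euclideanreal g" "\<forall>x\<in>topspace X. g (i x) = f x" .
  have g_eq: "g v = (\<Sum>x\<in>supp X i v. representation (i ` topspace X) v (i x) * f x)" for v
  proof -
    have "g v = g (\<Sum>x\<in>supp X i v. representation (i ` topspace X) v (i x) *\<^sub>R i x)"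
      by (simp add: free_lcs_expansion[OF X free])
    also have "\<dots> = (\<Sum>x\<in>supp X i v. representation (i ` topspace X) v (i x) * g (i x))"
      by (simp add: linear_sum[OF g(1)] linear_scale[OF g(1)])
    also have "\<dots> = (\<Sum>x\<in>supp X i v. representation (i ` topspace X) v (i x) * f x)"
      using g(3) by (intro sum.cong) (auto simp: supp_def)
    finally show ?thesis .
  qed
  have "openin L {v \<in> topspace L. g v \<in> ball 0 1}"
    using g(2) by (rule openin_continuous_map_preimage) simp
  then have "openin L {v. \<bar>g v\<bar> < 1}" by (simp add: L)
  moreover have "0 \<in> {v. \<bar>g v\<bar> < 1}" by (simp add: linear_0[OF g(1)])
  ultimately obtain s where s: "s > 0" "\<forall>t>s. A \<subseteq> (*\<^sub>R) t ` {v. \<bar>g v\<bar> < 1}"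
    using A unfolding lcs_bounded_def by blast
  have "\<bar>g v\<bar> \<le> s + 1" if v: "v \<in> A" for v
  proof -
    have "A \<subseteq> (*\<^sub>R) (s + 1) ` {v. \<bar>g v\<bar> < 1}" using s(2) by simp
    with v obtain u where "v = (s + 1) *\<^sub>R u" "\<bar>g u\<bar> < 1" by blast
    then show ?thesis using s(1) by (simp add: linear_scale[OF g(1)] abs_mult mult_left_le)
  qed
  then show ?thesis unfolding g_eq by blast
qed

lemma coeff_sup_finite_iff:
  "coeff_sup X i A < \<infinity> \<longleftrightarrow> (\<exists>c. \<forall>v\<in>A. coeff_norm X i v \<le> c)"
proof
  assume fin: "coeff_sup X i A < \<infinity>"
  have le: "ereal (coeff_norm X i v) \<le> coeff_sup X i A" if "v \<in> A" for v
    unfolding coeff_sup_def using that by (rule SUP_upper)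
  show "\<exists>c. \<forall>v\<in>A. coeff_norm X i v \<le> c"
  proof (cases "coeff_sup X i A")
    case (real r)
    then show ?thesis using le by auto
  next
    case MInf
    then show ?thesis using le by auto
  qed (use fin in simp)
next
  assume "\<exists>c. \<forall>v\<in>A. coeff_norm X i v \<le> c"
  then obtain c where "\<forall>v\<in>A. coeff_norm X i v \<le> c" ..
  then have "coeff_sup X i A \<le> ereal c"
    unfolding coeff_sup_def by (intro SUP_least) simp
  then show "coeff_sup X i A < \<infinity>" by (rule le_less_trans) simp
qed

text \<open>Inside a neighbourhood \<open>U\<close> of \<open>0\<close> sits the open unit ball of a continuous seminorm, which is
bounded by some \<open>r\<close> on the points of the supports, and so by \<open>\<bar>c\<bar> * r\<close> on \<open>A\<close>.\<close>

lemma bounded_if_support_functionally_bounded: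
  fixes L :: "'v::real_vector topology"
  assumes X: "completely_regular_space X" "Hausdorff_space X" and free: "free_lcs X L i"
    and S: "functionally_bounded_in X (supp_set X i A)"
    and c: "\<And>v. v \<in> A \<Longrightarrow> coeff_norm X i v \<le> c"
  shows "lcs_bounded L A"
  unfolding lcs_bounded_def
proof (intro conjI allI impI)
  have L: "lcs L" "topspace L = UNIV" and i: "continuous_map X L i"
    using free by (auto simp: free_lcs_def)
  show "A \<subseteq> topspace L" using L(2) by simp
  fix U assume "openin L U \<and> 0 \<in> U"
  then obtain B where B: "openin L B" "0 \<in> B" "convex B" "B \<subseteq> U" "\<forall>v\<in>B. - v \<in> B"
    by (elim conjE) (rule lcs_symmetric_convex_nbhd[OF L])
  note B' = B(1,2,3,5)
  have "continuous_map X euclideanreal (\<lambda>x. minkowski B (i x))"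
    using continuous_map_compose[OF i minkowski_continuous[OF L B']] by (simp add: o_def)
  then have "bounded ((\<lambda>x. minkowski B (i x)) ` supp_set X i A)"
    using S by (simp add: functionally_bounded_in_def)
  then obtain r where r: "r > 0" "\<forall>x\<in>supp_set X i A. \<bar>minkowski B (i x)\<bar> \<le> r"
    unfolding bounded_pos by auto
  have small: "minkowski B v \<le> \<bar>c\<bar> * r" if v: "v \<in> A" for v
  proof -
    let ?a = "\<lambda>x. representation (i ` topspace X) v (i x)"
    have "minkowski B v = minkowski B (\<Sum>x\<in>supp X i v. ?a x *\<^sub>R i x)"
      by (simp add: free_lcs_expansion[OF X free])
    also have "\<dots> \<le> (\<Sum>x\<in>supp X i v. \<bar>?a x\<bar> * minkowski B (i x))"
      by (rule minkowski_sum_le[OF L B' finite_supp[OF free_lcs_inj_on[OF X free]]])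
    also have "\<dots> \<le> (\<Sum>x\<in>supp X i v. \<bar>?a x\<bar> * r)"
    proof (intro sum_mono mult_left_mono)
      fix x assume "x \<in> supp X i v"
      with v have "x \<in> supp_set X i A" by (auto simp: supp_set_def)
      with r(2) show "minkowski B (i x) \<le> r" by fastforce
    qed simp
    also have "\<dots> = coeff_norm X i v * r"
      by (simp add: coeff_norm_def sum_distrib_right)
    also have "\<dots> \<le> \<bar>c\<bar> * r"
      using c[OF v] r(1) by (intro mult_right_mono) auto
    finally show ?thesis .
  qed
  show "\<exists>s>0. \<forall>t>s. A \<subseteq> (*\<^sub>R) t ` U"
  proof (intro exI[of _ "\<bar>c\<bar> * r + 1"] conjI allI impI subsetI)
    show "0 < \<bar>c\<bar> * r + 1" using r(1) by (simp add: add_nonneg_pos)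
    fix t v assume t: "\<bar>c\<bar> * r + 1 < t" and v: "v \<in> A"
    have "0 \<le> \<bar>c\<bar> * r" using r(1) by simp
    then have "t > 0" using t by linarith
    have "(1 / t) *\<^sub>R v \<in> B"
      using small[OF v] t by (intro minkowski_less_imp[OF L B']) simp
    then have "(1 / t) *\<^sub>R v \<in> U" "v = t *\<^sub>R ((1 / t) *\<^sub>R v)"
      using B(4) \<open>t > 0\<close> by auto
    then show "v \<in> (*\<^sub>R) t ` U" by blast
  qed
qed

theorem lcs_bounded_iff_functionally_bounded:
  fixes L :: "'v::real_vector topology"
  assumes X: "completely_regular_space X" "Hausdorff_space X" and free: "free_lcs X L i"
  shows "lcs_bounded L A \<longleftrightarrow>
    functionally_bounded_in X (supp_set X i A) \<and> coeff_sup X i A < \<infinity>"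
proof
  assume A: "lcs_bounded L A"
  let ?a = "\<lambda>v x. representation (i ` topspace X) v (i x)"
  have T: "finite (supp X i v) \<and> supp X i v \<subseteq> topspace X" for v
    using finite_supp[OF free_lcs_inj_on[OF X free]] by (auto simp: supp_def)
  have "functionally_bounded_in X (\<Union>v\<in>A. supp X i v)"
    by (rule supports_functionally_bounded[where a = ?a, OF X T _ bounded_imp_pointwise_bounded[OF X free A]])
      (auto simp: supp_def)
  moreover have "\<exists>c. \<forall>v\<in>A. (\<Sum>x\<in>supp X i v. \<bar>?a v x\<bar>) \<le> c"
    by (rule uniform_bound_of_coefficient_sums[OF X T bounded_imp_pointwise_bounded[OF X free A]])
  ultimately show "functionally_bounded_in X (supp_set X i A) \<and> coeff_sup X i A < \<infinity>"
    unfolding coeff_sup_finite_iff coeff_norm_def supp_set_def by blast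
next
  assume "functionally_bounded_in X (supp_set X i A) \<and> coeff_sup X i A < \<infinity>"
  then show "lcs_bounded L A"
    unfolding coeff_sup_finite_iff using bounded_if_support_functionally_bounded[OF X free] by blast
qed

section \<open>The characterisation\<close>

theorem proposition2p7:
  fixes X :: "'a topology"
    and L :: "'v::real_vector topology" and i :: "'a \<Rightarrow> 'v"
    and M :: "'c set" and V :: "('c \<times> 'c) filter" and j :: "'a \<Rightarrow> 'c"
    and A :: "'v set"
  assumes "completely_regular_space X" and "Hausdorff_space X"
    and "free_lcs X L i"
    and "dieudonne_completion X M V j"
    and "A \<noteq> {}" and "A \<noteq> {0}"
  shows "(lcs_bounded L A \<longleftrightarrow>
            compactin (uniform_topology M V) (uniform_topology M V closure_of (j ` supp_set X i A))
            \<and> coeff_sup X i A < \<infinity>) \<and>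
         (lcs_bounded L A \<longleftrightarrow>
            functionally_bounded_in X (supp_set X i A) \<and> coeff_sup X i A < \<infinity>)"
proof -
  have supp: "supp_set X i A \<subseteq> topspace X"
    by (auto simp: supp_set_def supp_def)
  show ?thesis
    unfolding functionally_bounded_iff_compact_closure[OF assms(1) supp assms(4), symmetric]
    using lcs_bounded_iff_functionally_bounded[OF assms(1-3)] by blast
qed

end
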